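(* Let $X$ be a non-empty metrizable space. The following are equivalent: (1) $F(X)$ is a $k$-space; (2) $F_{8}(X)$ is a $k$-space; (3) $F_{8}(X)$ is a $k_{R}$-space; (4) $X$ is locally compact and separable, or $X$ is discrete.
   Context: $F(X)$ denotes the free topological group (in the sense of Markov) over a Tychonoff space $X$, with free basis $X$. For $n\in\mathbb{N}$ (positive integers), $F_n(X)$ denotes the subspace of $F(X)$ consisting of all words of reduced length at most $n$ with respect to the free basis $X$. A topological space $Z$ is a $k$-space if a subset $A\subseteq Z$ is closed in $Z$ whenever $A\cap C$ is closed in $C$ for every compact $C\subseteq Z$. A topological space $Z$ is a $k_{R}$-space if $Z$ is Tychonoff and every function $f:Z\to\mathbb{R}$ whose restriction to each compact subset of $Z$ is continuous is itself continuous on $Z$. *)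

theory Defs
  imports "HOL-Analysis.Analysis" "HOL-Algebra.Generated_Groups"
begin

text \<open>A letter is a signed generator: \<open>(True, x)\<close> stands for \<open>x\<close> and \<open>(False, x)\<close> for
  the formal inverse of \<open>x\<close>. The free group with basis \<open>A\<close> consists of the reduced words, so
  the reduced length of an element is its length as a list.\<close>

type_synonym 'a word = "(bool \<times> 'a) list"

definition inv_letter :: "bool \<times> 'a \<Rightarrow> bool \<times> 'a" where
  "inv_letter a = (\<not> fst a, snd a)"

definition reduced_word :: "'a word \<Rightarrow> bool" where
  "reduced_word w \<longleftrightarrow> successively (\<lambda>a b. b \<noteq> inv_letter a) w"

fun push :: "bool \<times> 'a \<Rightarrow> 'a word \<Rightarrow> 'a word" where
  "push a [] = [a]"
| "push a (b # w) = (if b = inv_letter a then w else a # b # w)"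

definition free_group :: "'a set \<Rightarrow> 'a word monoid" where
  "free_group A =
     \<lparr>carrier = {w. reduced_word w \<and> set w \<subseteq> UNIV \<times> A},
      mult = (\<lambda>u v. foldr push u v),
      one = []\<rparr>"

definition generator :: "'a \<Rightarrow> 'a word" where
  "generator x = [(True, x)]"

definition topological_group :: "('g, 'm) monoid_scheme \<Rightarrow> 'g topology \<Rightarrow> bool" where
  "topological_group G T \<longleftrightarrow>
     group G \<and> topspace T = carrier G \<and>
     continuous_map (prod_topology T T) T (\<lambda>(x, y). x \<otimes>\<^bsub>G\<^esub> y) \<and>
     continuous_map T T (\<lambda>x. inv\<^bsub>G\<^esub> x)"

text \<open>The free topological group \<open>F(X)\<close> in the sense of Markov is the abstract free group on the
  points of \<open>X\<close> with the finest group topology making the inclusion of \<open>X\<close> continuous, built here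
  as the join of all such group topologies. Markov's defining properties are proved
  below: \<open>topological_group_free_topology\<close>, \<open>embedding_map_generator\<close> (for completely regular
  \<open>X\<close>), \<open>generate_generator\<close>, and the universal property \<open>free_topology_universal\<close> with respect
  to topological groups over an arbitrary type.\<close>

definition free_topology :: "'a topology \<Rightarrow> 'a word topology" where
  "free_topology X = topology_generated_by
     {U. \<exists>T. topological_group (free_group (topspace X)) T \<and> continuous_map X T generator \<and>
             openin T U}"

definition free_topology_le :: "nat \<Rightarrow> 'a topology \<Rightarrow> 'a word topology" where
  "free_topology_le n X =
     subtopology (free_topology X) {w \<in> carrier (free_group (topspace X)). length w \<le> n}"

definition tychonoff_space :: "'a topology \<Rightarrow> bool" where
  "tychonoff_space Z \<longleftrightarrow> completely_regular_space Z \<and> Hausdorff_space Z"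

definition kR_space :: "'a topology \<Rightarrow> bool" where
  "kR_space Z \<longleftrightarrow> tychonoff_space Z \<and>
     (\<forall>f :: 'a \<Rightarrow> real.
        (\<forall>K. compactin Z K \<longrightarrow> continuous_map (subtopology Z K) euclideanreal f) \<longrightarrow>
        continuous_map Z euclideanreal f)"

lemma inv_letter_inv_letter [simp]: "inv_letter (inv_letter a) = a"
  by (simp add: inv_letter_def)

lemma inv_letter_eq_iff [simp]: "inv_letter a = inv_letter b \<longleftrightarrow> a = b"
  by (auto simp: inv_letter_def prod_eq_iff)

lemma reduced_Nil [simp]: "reduced_word []"
  by (simp add: reduced_word_def)

lemma reduced_single [simp]: "reduced_word [a]"
  by (simp add: reduced_word_def)

lemma reduced_Cons_Cons [simp]: "reduced_word (a # b # w) \<longleftrightarrow> b \<noteq> inv_letter a \<and> reduced_word (b # w)"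
  by (simp add: reduced_word_def)

lemma reduced_ConsD: "reduced_word (a # w) \<Longrightarrow> reduced_word w"
  by (cases w) auto

lemma reduced_push: "reduced_word w \<Longrightarrow> reduced_word (push a w)"
  by (cases w) (auto dest: reduced_ConsD)

lemma set_push: "set (push a w) \<subseteq> insert a (set w)"
  by (cases w) auto

lemma push_reduced: "reduced_word (a # w) \<Longrightarrow> push a w = a # w"
  by (cases w) auto

lemma push_push_inv:
  assumes "reduced_word w"
  shows "push a (push (inv_letter a) w) = w"
proof (cases w)
  case (Cons b v)
  then show ?thesis
    using assms by (cases "b = a") (auto intro: push_reduced)
qed simp

lemma reduced_foldr_push: "reduced_word v \<Longrightarrow> reduced_word (foldr push u v)"
  by (induction u) (auto intro: reduced_push)

lemma set_foldr_push: "set (foldr push u v) \<subseteq> set u \<union> set v"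
proof (induction u)
  case (Cons a u)
  then show ?case using set_push[of a "foldr push u v"] by auto
qed simp

lemma foldr_push_push:
  assumes "reduced_word v"
  shows "foldr push (push a u) v = push a (foldr push u v)"
proof (cases u)
  case (Cons b u')
  then show ?thesis
    using push_push_inv[OF reduced_foldr_push[OF assms, of u'], of a] by simp
qed simp

lemma foldr_push_assoc:
  "reduced_word z \<Longrightarrow> foldr push (foldr push u v) z = foldr push u (foldr push v z)"
  by (induction u) (auto simp: foldr_push_push)

lemma foldr_push_Nil: "reduced_word w \<Longrightarrow> foldr push w [] = w"
proof (induction w)
  case (Cons a w)
  then show ?case using reduced_ConsD[OF Cons.prems] by (simp add: push_reduced)
qed simp

lemma reduced_inverse: "reduced_word w \<Longrightarrow> reduced_word (rev (map inv_letter w))"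
  unfolding reduced_word_def successively_rev successively_map
  by (rule successively_mono[rotated]) auto

lemma foldr_push_inverse: "foldr push (rev (map inv_letter w)) w = []"
  by (induction w) auto

lemma carrier_free_group: "carrier (free_group A) = {w. reduced_word w \<and> set w \<subseteq> UNIV \<times> A}"
  by (simp add: free_group_def)

lemma mult_free_group: "u \<otimes>\<^bsub>free_group A\<^esub> v = foldr push u v"
  by (simp add: free_group_def)

lemma one_free_group: "\<one>\<^bsub>free_group A\<^esub> = []"
  by (simp add: free_group_def)

lemmas free_group_simps = carrier_free_group mult_free_group one_free_group

lemma inverse_in_free_group:
  "w \<in> carrier (free_group A) \<Longrightarrow> rev (map inv_letter w) \<in> carrier (free_group A)"
  by (auto simp: free_group_simps reduced_inverse inv_letter_def)

lemma group_free_group: "group (free_group A)"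
proof (rule groupI)
  fix u v assume "u \<in> carrier (free_group A)" "v \<in> carrier (free_group A)"
  then show "u \<otimes>\<^bsub>free_group A\<^esub> v \<in> carrier (free_group A)"
    using set_foldr_push[of u v] by (auto simp: free_group_simps reduced_foldr_push)
next
  fix w assume w: "w \<in> carrier (free_group A)"
  show "\<exists>y\<in>carrier (free_group A). y \<otimes>\<^bsub>free_group A\<^esub> w = \<one>\<^bsub>free_group A\<^esub>"
    by (rule bexI[OF _ inverse_in_free_group[OF w]]) (simp add: free_group_simps foldr_push_inverse)
qed (auto simp: free_group_simps foldr_push_assoc)

lemma generator_in_free_group: "x \<in> A \<Longrightarrow> generator x \<in> carrier (free_group A)"
  by (auto simp: free_group_simps generator_def)

lemma inv_generator:
  assumes "x \<in> A" shows "inv\<^bsub>free_group A\<^esub> (generator x) = [(False, x)]"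
proof (rule group.inv_equality[OF group_free_group])
  show "[(False, x)] \<otimes>\<^bsub>free_group A\<^esub> generator x = \<one>\<^bsub>free_group A\<^esub>"
    by (simp add: free_group_simps generator_def inv_letter_def)
qed (use assms in \<open>auto simp: free_group_simps generator_def\<close>)

lemma generate_generator:
  "generate (free_group A) (generator ` A) = carrier (free_group A)"
proof
  show "generate (free_group A) (generator ` A) \<subseteq> carrier (free_group A)"
    by (intro group.generate_incl[OF group_free_group]) (auto intro: generator_in_free_group)
  have "w \<in> generate (free_group A) (generator ` A)" if "reduced_word w" "set w \<subseteq> UNIV \<times> A" for w
    using that
  proof (induction w)
    case Nil
    then show ?case
      using generate.one[of "free_group A"] by (simp add: one_free_group)
  next
    case (Cons a w)
    obtain b x where a: "a = (b, x)" by force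
    with Cons.prems have x: "x \<in> A" by auto
    have "[a] \<in> generate (free_group A) (generator ` A)"
    proof (cases b)
      case True
      then show ?thesis
        using generate.incl[of "generator x" "generator ` A" "free_group A"] x
        by (auto simp: a generator_def)
    next
      case False
      then show ?thesis
        using generate.inv[of "generator x" "generator ` A" "free_group A"] x
        by (auto simp: a inv_generator)
    qed
    moreover have "w \<in> generate (free_group A) (generator ` A)"
      using Cons by (auto dest: reduced_ConsD)
    ultimately have "[a] \<otimes>\<^bsub>free_group A\<^esub> w \<in> generate (free_group A) (generator ` A)"
      by (rule generate.eng)
    then show ?case
      using Cons.prems(1) by (simp add: mult_free_group push_reduced)
  qed
  then show "carrier (free_group A) \<subseteq> generate (free_group A) (generator ` A)"
    by (auto simp: carrier_free_group)
qed

definition word_eval :: "('g, 'm) monoid_scheme \<Rightarrow> ('a \<Rightarrow> 'g) \<Rightarrow> 'a word \<Rightarrow> 'g" where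
  "word_eval G f w =
     foldr (\<lambda>a g. (if fst a then f (snd a) else inv\<^bsub>G\<^esub> (f (snd a))) \<otimes>\<^bsub>G\<^esub> g) w \<one>\<^bsub>G\<^esub>"

lemma word_eval_Nil [simp]: "word_eval G f [] = \<one>\<^bsub>G\<^esub>"
  by (simp add: word_eval_def)

lemma word_eval_Cons [simp]:
  "word_eval G f (a # w) =
     (if fst a then f (snd a) else inv\<^bsub>G\<^esub> (f (snd a))) \<otimes>\<^bsub>G\<^esub> word_eval G f w"
  by (simp add: word_eval_def)

context
  fixes G :: "('g, 'm) monoid_scheme" (structure) and f :: "'a \<Rightarrow> 'g" and A :: "'a set"
  assumes G: "group G" and f: "f ` A \<subseteq> carrier G"
begin

interpretation group G by (rule G)

lemma word_eval_closed: "set w \<subseteq> UNIV \<times> A \<Longrightarrow> word_eval G f w \<in> carrier G"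
  using f by (induction w) auto

lemma word_eval_push:
  assumes "snd a \<in> A" "set w \<subseteq> UNIV \<times> A"
  shows "word_eval G f (push a w) =
           (if fst a then f (snd a) else inv (f (snd a))) \<otimes> word_eval G f w"
proof (cases w)
  case (Cons b v)
  show ?thesis
  proof (cases "b = inv_letter a")
    case True
    have "f (snd a) \<in> carrier G" "word_eval G f v \<in> carrier G"
      using assms Cons f by (auto intro: word_eval_closed)
    then show ?thesis
      using Cons True by (auto simp: inv_letter_def m_assoc[symmetric])
  qed (use Cons in auto)
qed simp

lemma word_eval_foldr_push:
  assumes "set u \<subseteq> UNIV \<times> A" "set v \<subseteq> UNIV \<times> A"
  shows "word_eval G f (foldr push u v) = word_eval G f u \<otimes> word_eval G f v"
  using assms(1)
proof (induction u)
  case Nil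
  then show ?case using word_eval_closed[OF assms(2)] by simp
next
  case (Cons a u)
  have 1: "snd a \<in> A" "set u \<subseteq> UNIV \<times> A"
    using Cons.prems by auto
  have 2: "set (foldr push u v) \<subseteq> UNIV \<times> A"
    using set_foldr_push[of u v] 1 assms(2) by blast
  have "f (snd a) \<in> carrier G" using 1 f by auto
  then show ?case
    using Cons.IH[OF 1(2)] word_eval_push[OF 1(1) 2]
      word_eval_closed[OF 1(2)] word_eval_closed[OF assms(2)]
    by (simp add: m_assoc)
qed

lemma word_eval_hom: "word_eval G f \<in> hom (free_group A) G"
  by (rule homI) (auto simp: free_group_simps word_eval_foldr_push intro: word_eval_closed)

lemma word_eval_generator: "x \<in> A \<Longrightarrow> word_eval G f (generator x) = f x"
  using f by (auto simp: generator_def)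

end

lemma topological_group_pullback:
  assumes G: "topological_group G S" and H: "group H" and h: "h \<in> hom H G"
  shows "topological_group H (pullback_topology (carrier H) h S)"
proof -
  interpret G: group G using G by (simp add: topological_group_def)
  interpret H: group H by (rule H)
  interpret group_hom H G h by unfold_locales (rule h)
  let ?T = "pullback_topology (carrier H) h S"
  have S: "topspace S = carrier G" using G by (simp add: topological_group_def)
  have T: "topspace ?T = carrier H"
    by (auto simp: topspace_pullback_topology S)
  have cont: "continuous_map ?T S h"
    using continuous_map_pullback[of S S id "carrier H" h] by simp
  have "continuous_map (prod_topology ?T ?T) S
          ((\<lambda>(x, y). x \<otimes>\<^bsub>G\<^esub> y) \<circ> (\<lambda>z. (h (fst z), h (snd z))))"
  proof (rule continuous_map_compose)
    show "continuous_map (prod_topology ?T ?T) (prod_topology S S) (\<lambda>z. (h (fst z), h (snd z)))"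
      by (intro continuous_map_pairedI continuous_map_compose[OF _ cont, unfolded o_def]
          continuous_map_fst continuous_map_snd)
    show "continuous_map (prod_topology S S) S (\<lambda>(x, y). x \<otimes>\<^bsub>G\<^esub> y)"
      using G by (simp add: topological_group_def)
  qed
  then have "continuous_map (prod_topology ?T ?T) S (h \<circ> (\<lambda>(x, y). x \<otimes>\<^bsub>H\<^esub> y))"
    by (rule continuous_map_eq) (auto simp: T)
  then have mult: "continuous_map (prod_topology ?T ?T) ?T (\<lambda>(x, y). x \<otimes>\<^bsub>H\<^esub> y)"
    by (rule continuous_map_pullback') (auto simp: T)
  have "continuous_map ?T S ((\<lambda>x. inv\<^bsub>G\<^esub> x) \<circ> h)"
    using G by (intro continuous_map_compose[OF cont]) (simp add: topological_group_def)
  then have "continuous_map ?T S (h \<circ> (\<lambda>x. inv\<^bsub>H\<^esub> x))"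
    by (rule continuous_map_eq) (auto simp: T)
  then have "continuous_map ?T ?T (\<lambda>x. inv\<^bsub>H\<^esub> x)"
    by (rule continuous_map_pullback') (auto simp: T)
  with mult T H show ?thesis by (simp add: topological_group_def)
qed

lemma openin_free_topology:
  assumes "topological_group (free_group (topspace X)) T" "continuous_map X T generator" "openin T U"
  shows "openin (free_topology X) U"
  unfolding free_topology_def by (rule topology_generated_by_Basis) (use assms in blast)

lemma topspace_free_topology: "topspace (free_topology X) = carrier (free_group (topspace X))"
proof -
  let ?F = "free_group (topspace X)"
  let ?T = "pullback_topology (carrier ?F) (\<lambda>_. ()) (discrete_topology {()})"
  interpret F: group ?F by (rule group_free_group)
  have T: "openin ?T U \<longleftrightarrow> U = {} \<or> U = carrier ?F" for U
  proof -
    have "openin ?T U \<longleftrightarrow> (\<exists>V :: unit set. U = (\<lambda>_. ()) -` V \<inter> carrier ?F)"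
      by (auto simp: openin_pullback_topology subset_iff)
    also have "\<dots> \<longleftrightarrow> U = {} \<or> U = carrier ?F"
    proof
      assume "\<exists>V :: unit set. U = (\<lambda>_. ()) -` V \<inter> carrier ?F"
      then obtain V :: "unit set" where "U = (\<lambda>_. ()) -` V \<inter> carrier ?F" by blast
      then show "U = {} \<or> U = carrier ?F"
        by (cases "() \<in> V") auto
    next
      assume "U = {} \<or> U = carrier ?F"
      then show "\<exists>V :: unit set. U = (\<lambda>_. ()) -` V \<inter> carrier ?F"
        by (auto intro: exI[of _ "{}"] exI[of _ UNIV])
    qed
    finally show ?thesis .
  qed
  have sp: "topspace ?T = carrier ?F" by (auto simp: topspace_pullback_topology)
  have g1: "topological_group ?F ?T"
  proof -
    have inv: "(\<lambda>x. inv\<^bsub>?F\<^esub> x) \<in> carrier ?F \<rightarrow> carrier ?F"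
      and mult: "(\<lambda>(x, y). x \<otimes>\<^bsub>?F\<^esub> y) \<in> carrier ?F \<times> carrier ?F \<rightarrow> carrier ?F"
      by auto
    have "continuous_map (prod_topology ?T ?T) ?T (\<lambda>(x, y). x \<otimes>\<^bsub>?F\<^esub> y)"
      by (rule continuous_map_pullback', simp add: o_def)
         (use mult in \<open>simp only: topspace_prod_topology sp Pi_iff vimage_eq subset_iff, blast\<close>)
    moreover have "continuous_map ?T ?T (\<lambda>x. inv\<^bsub>?F\<^esub> x)"
      by (rule continuous_map_pullback', simp add: o_def)
         (use inv in \<open>simp only: sp Pi_iff vimage_eq subset_iff, blast\<close>)
    ultimately show ?thesis by (simp add: topological_group_def sp F.is_group)
  qed
  have g2: "continuous_map X ?T generator"
    by (intro continuous_map_pullback') (auto simp: o_def generator_in_free_group)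
  have "openin ?T (carrier ?F)" by (simp add: T)
  then have "carrier ?F \<subseteq> topspace (free_topology X)"
    by (intro openin_subset openin_free_topology[OF g1 g2])
  moreover have "topspace (free_topology X) \<subseteq> carrier ?F"
    unfolding free_topology_def topology_generated_by_topspace
    by (auto simp: topological_group_def dest: openin_subset)
  ultimately show ?thesis by blast
qed

lemma continuous_map_free_topology_id:
  assumes "topological_group (free_group (topspace X)) T" "continuous_map X T generator"
  shows "continuous_map (free_topology X) T id"
  unfolding continuous_map_alt
proof (intro conjI allI impI)
  fix U assume U: "openin T U"
  then have "U \<subseteq> topspace (free_topology X)"
    using assms(1) openin_subset[OF U] by (simp add: topspace_free_topology topological_group_def)
  then have "id -` U \<inter> topspace (free_topology X) = U" by auto
  then show "openin (free_topology X) (id -` U \<inter> topspace (free_topology X))"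
    using openin_free_topology[OF assms U] by simp
qed (use assms in \<open>auto simp: topspace_free_topology topological_group_def\<close>)

lemma continuous_map_into_free_topology:
  assumes "\<And>T. topological_group (free_group (topspace X)) T \<Longrightarrow> continuous_map X T generator \<Longrightarrow>
             continuous_map Y T g"
    and "g ` topspace Y \<subseteq> carrier (free_group (topspace X))"
  shows "continuous_map Y (free_topology X) g"
  unfolding free_topology_def
proof (rule continuous_on_generated_topo)
  show "g ` topspace Y \<subseteq> \<Union> {U. \<exists>T. topological_group (free_group (topspace X)) T \<and>
          continuous_map X T generator \<and> openin T U}"
    using assms(2) topspace_free_topology[of X]
    unfolding free_topology_def topology_generated_by_topspace by simp
qed (use assms(1) in \<open>auto simp: continuous_map_alt\<close>)

lemma continuous_map_generator: "continuous_map X (free_topology X) generator"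
  by (rule continuous_map_into_free_topology) (auto intro: generator_in_free_group)

theorem topological_group_free_topology:
  "topological_group (free_group (topspace X)) (free_topology X)"
proof -
  let ?F = "free_group (topspace X)"
  interpret F: group ?F by (rule group_free_group)
  have "continuous_map (prod_topology (free_topology X) (free_topology X)) T (\<lambda>(x, y). x \<otimes>\<^bsub>?F\<^esub> y)"
    if T: "topological_group ?F T" "continuous_map X T generator" for T
  proof -
    note id = continuous_map_free_topology_id[OF T]
    have "continuous_map (prod_topology (free_topology X) (free_topology X)) (prod_topology T T)
            (\<lambda>z. (id (fst z), id (snd z)))"
      by (intro continuous_map_pairedI continuous_map_compose[OF _ id, unfolded o_def]
          continuous_map_fst continuous_map_snd)
    moreover have "continuous_map (prod_topology T T) T (\<lambda>(x, y). x \<otimes>\<^bsub>?F\<^esub> y)"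
      using T(1) by (simp add: topological_group_def)
    ultimately have "continuous_map (prod_topology (free_topology X) (free_topology X)) T
        ((\<lambda>(x, y). x \<otimes>\<^bsub>?F\<^esub> y) \<circ> (\<lambda>z. (id (fst z), id (snd z))))"
      by (rule continuous_map_compose)
    then show ?thesis by (simp add: o_def case_prod_unfold)
  qed
  then have "continuous_map (prod_topology (free_topology X) (free_topology X)) (free_topology X)
               (\<lambda>(x, y). x \<otimes>\<^bsub>?F\<^esub> y)"
    by (rule continuous_map_into_free_topology) (auto simp: topspace_free_topology)
  moreover have "continuous_map (free_topology X) T (\<lambda>x. inv\<^bsub>?F\<^esub> x)"
    if T: "topological_group ?F T" "continuous_map X T generator" for T
    using continuous_map_compose[OF continuous_map_free_topology_id[OF T], of T "\<lambda>x. inv\<^bsub>?F\<^esub> x"] T(1)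
    by (simp add: topological_group_def o_def)
  then have "continuous_map (free_topology X) (free_topology X) (\<lambda>x. inv\<^bsub>?F\<^esub> x)"
    by (rule continuous_map_into_free_topology) (auto simp: topspace_free_topology)
  ultimately show ?thesis
    by (simp add: topological_group_def topspace_free_topology F.is_group)
qed

theorem free_topology_universal:
  assumes G: "topological_group G S" and f: "continuous_map X S f"
  shows "\<exists>h. h \<in> hom (free_group (topspace X)) G \<and> continuous_map (free_topology X) S h \<and>
             (\<forall>x\<in>topspace X. h (generator x) = f x)" (is ?ex)
    and "\<lbrakk>h1 \<in> hom (free_group (topspace X)) G; h2 \<in> hom (free_group (topspace X)) G;
          \<And>x. x \<in> topspace X \<Longrightarrow> h1 (generator x) = h2 (generator x);
          w \<in> carrier (free_group (topspace X))\<rbrakk> \<Longrightarrow> h1 w = h2 w"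
proof -
  let ?F = "free_group (topspace X)"
  interpret F: group ?F by (rule group_free_group)
  have grp: "group G" and S: "topspace S = carrier G"
    using G by (auto simp: topological_group_def)
  interpret G: group G by (rule grp)
  have fA: "f ` topspace X \<subseteq> carrier G"
    using f S by (auto simp: continuous_map_def)
  let ?h = "word_eval G f"
  have hom: "?h \<in> hom ?F G" by (rule word_eval_hom[OF grp fA])
  have gen: "?h (generator x) = f x" if "x \<in> topspace X" for x
    by (rule word_eval_generator[OF grp fA that])
  let ?T = "pullback_topology (carrier ?F) ?h S"
  have T: "topological_group ?F ?T"
    by (rule topological_group_pullback[OF G F.is_group hom])
  have "continuous_map X S (?h \<circ> generator)"
    by (rule continuous_map_eq[OF f]) (simp add: gen)
  then have "continuous_map X ?T generator"
    by (rule continuous_map_pullback') (auto intro: generator_in_free_group)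
  then have "continuous_map (free_topology X) ?T id"
    by (rule continuous_map_free_topology_id[OF T])
  moreover have "continuous_map ?T S ?h"
    using continuous_map_pullback[of S S id "carrier ?F" ?h] by simp
  ultimately have "continuous_map (free_topology X) S (?h \<circ> id)"
    by (rule continuous_map_compose)
  with hom gen show ?ex by auto
  show "h1 w = h2 w"
    if h: "h1 \<in> hom ?F G" "h2 \<in> hom ?F G"
      "\<And>x. x \<in> topspace X \<Longrightarrow> h1 (generator x) = h2 (generator x)"
      and w: "w \<in> carrier ?F"
  proof -
    interpret h1: group_hom ?F G h1 by unfold_locales (rule h)
    interpret h2: group_hom ?F G h2 by unfold_locales (rule h)
    have sub: "generate ?F (generator ` topspace X) \<subseteq> carrier ?F"
      by (simp add: generate_generator)
    have "w \<in> generate ?F (generator ` topspace X)"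
      using w by (simp add: generate_generator)
    then show ?thesis
    proof (induction w rule: generate.induct)
      case (eng a b)
      then have "a \<in> carrier ?F" "b \<in> carrier ?F" using sub by auto
      with eng show ?case by simp
    qed (auto simp: h(3) generator_in_free_group)
  qed
qed

theorem embedding_map_generator:
  assumes X: "completely_regular_space X"
  shows "embedding_map X (free_topology X) generator"
proof -
  let ?F = "free_group (topspace X)"
  let ?R = "\<lparr>carrier = UNIV, mult = (+), one = 0\<rparr> :: real monoid"
  let ?I = "subtopology (free_topology X) (generator ` topspace X)"
  have R: "group ?R"
  proof (rule groupI)
    fix x assume "x \<in> carrier ?R"
    show "\<exists>y\<in>carrier ?R. y \<otimes>\<^bsub>?R\<^esub> x = \<one>\<^bsub>?R\<^esub>"
      by (rule bexI[of _ "- x"]) auto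
  qed auto
  interpret R: group ?R by (rule R)
  have invR: "inv\<^bsub>?R\<^esub> x = - x" for x
    by (rule R.inv_equality) auto
  have "continuous_map (prod_topology euclideanreal euclideanreal) euclideanreal (\<lambda>z. fst z + snd z)"
    by (intro continuous_map_add continuous_map_fst continuous_map_snd)
  then have TR: "topological_group ?R euclideanreal"
    by (auto simp: topological_group_def R case_prod_unfold invR intro!: continuous_map_minus)
  have im: "generator ` topspace X \<subseteq> topspace (free_topology X)"
    by (auto simp: topspace_free_topology generator_in_free_group)
  have "openin ?I (generator ` U)" if U: "openin X U" for U
  proof (subst openin_subopen, intro ballI)
    fix w assume "w \<in> generator ` U"
    then obtain x where x: "x \<in> U" "w = generator x" by blast
    with U have "x \<in> topspace X - (topspace X - U)" "closedin X (topspace X - U)"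
      by (auto dest: openin_subset)
    with X obtain f where f: "continuous_map X (top_of_set {0..1::real}) f" "f x = 0"
        "f ` (topspace X - U) \<subseteq> {1}"
      unfolding completely_regular_space_def by metis
    then have "continuous_map X euclideanreal f"
      by (simp add: continuous_map_in_subtopology)
    from free_topology_universal(1)[OF TR this] obtain h
      where h: "continuous_map (free_topology X) euclideanreal h"
        "\<And>x. x \<in> topspace X \<Longrightarrow> h (generator x) = f x" by blast
    let ?V = "{v \<in> topspace (free_topology X). h v \<in> {..<1}}"
    have V: "openin (free_topology X) ?V"
      by (rule openin_continuous_map_preimage[OF h(1)]) simp
    show "\<exists>T. openin ?I T \<and> w \<in> T \<and> T \<subseteq> generator ` U"
    proof (intro exI conjI)
      show "openin ?I (?V \<inter> generator ` topspace X)"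
        using V by (auto simp: openin_subtopology)
      show "w \<in> ?V \<inter> generator ` topspace X"
        using x im f(2) h(2) openin_subset[OF U] by auto
      show "?V \<inter> generator ` topspace X \<subseteq> generator ` U"
        using f(3) h(2) by force
    qed
  qed
  then have "open_map X ?I generator" by (simp add: open_map_def)
  moreover have "continuous_map X ?I generator"
    by (simp add: continuous_map_in_subtopology continuous_map_generator)
  moreover have "generator ` topspace X = topspace ?I"
    using im by auto
  ultimately show ?thesis
    unfolding embedding_map_def
    by (intro bijective_open_imp_homeomorphic_map) (auto simp: inj_on_def generator_def)
qed

end

theory Submission
  imports Defs
begin

text \<open>Suppose \<open>X\<close> is neither discrete nor both locally compact and separable. Fix a sequence \<open>x\<^sub>n\<close> of
  points other than \<open>p\<close> converging to \<open>p\<close>. If \<open>X\<close> is not separable, take an uncountable separated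
  set of points \<open>a\<close> and the words \<open>(a x\<^sub>n p\<inverse> a\<inverse>) (b x\<^sub>n p\<inverse> b\<inverse>)\<close>, where \<open>n\<close> is the first
  difference of \<open>a \<noteq> b\<close> seen as sets of natural numbers; if \<open>p\<close> has no compact neighbourhood, take
  infinite closed discrete sets \<open>{a\<^sub>n\<^sub>i : i}\<close> shrinking to \<open>p\<close>, another one \<open>{d\<^sub>n : n}\<close>, and the words
  \<open>(a\<^sub>n\<^sub>i p\<inverse>) (d\<^sub>n x\<^sub>i p\<inverse> d\<^sub>n\<inverse>)\<close>. In both cases the identity is an accumulation point of the words,
  which have length at most 8. Homomorphisms \<open>x \<mapsto> (\<phi> x, \<psi> x, 0)\<close> into the Heisenberg group, with
  \<open>\<phi>\<close> a bump function, give a continuous nonnegative function for each word, nonzero at it and zero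
  at the identity; a compact set meets the supports of only finitely many of them. Their sum,
  normalised to be at least 1 at each word, is continuous on compact sets but not at the identity.

  Conversely, if \<open>X\<close> has an exhaustion by compact sets \<open>K\<^sub>n\<close>, the words of length at most \<open>n\<close> in
  letters from \<open>K\<^sub>n\<close> form compact sets \<open>C\<^sub>n\<close>. The weak topology determined by the \<open>C\<^sub>n\<close> is a group
  topology, because products of two such weak topologies are again weak (Milnor). It therefore
  coincides with the free topology, which is thus a \<open>k\<close>-space; being regular and
  \<open>\<sigma>\<close>-compact, it is also normal.\<close>

section \<open>Words and continuous maps\<close>

lemma length_foldr_push: "length (foldr push u v) \<le> length u + length v"
proof (induction u)
  case (Cons a u)
  have "length (push a w) \<le> Suc (length w)" for w by (cases w) auto
  from this[of "foldr push u v"] show ?case using Cons by simp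
qed simp

lemma foldr_push_append_Nil: "foldr push (u @ v) [] = foldr push (foldr push u []) (foldr push v [])"
  by (simp add: foldr_push_assoc reduced_foldr_push)

lemma reduce_in_free_group:
  "set u \<subseteq> UNIV \<times> A \<Longrightarrow> foldr push u [] \<in> carrier (free_group A)"
  using set_foldr_push[of u "[]"] by (auto simp: carrier_free_group reduced_foldr_push)

lemma continuous_map_foldr_push:
  "continuous_map (prod_topology (free_topology X) (free_topology X)) (free_topology X)
     (\<lambda>(u, v). foldr push u v)"
  using topological_group_free_topology[of X] by (simp add: topological_group_def mult_free_group)

lemma continuous_map_free_group_mult:
  assumes "continuous_map Y (free_topology X) f" "continuous_map Y (free_topology X) g"
  shows "continuous_map Y (free_topology X) (\<lambda>y. foldr push (f y) (g y))"
  using continuous_map_compose[OF continuous_map_pairedI[OF assms] continuous_map_foldr_push]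
  by (simp add: o_def)

text \<open>Left multiplication by a one-letter word, so that words with a moving letter can be
  treated one letter at a time. A negative letter is the inverse of a generator.\<close>

lemma continuous_map_push:
  assumes f: "continuous_map Y (free_topology X) f" and g: "continuous_map Y X g"
  shows "continuous_map Y (free_topology X) (\<lambda>y. push (b, g y) (f y))"
proof -
  have gen: "continuous_map Y (free_topology X) (generator \<circ> g)"
    by (rule continuous_map_compose[OF g continuous_map_generator])
  have "continuous_map Y (free_topology X) (\<lambda>y. [(b, g y)])"
  proof (cases b)
    case True
    then show ?thesis using gen by (simp add: o_def generator_def)
  next
    case False
    have "continuous_map (free_topology X) (free_topology X)
            (\<lambda>w. inv\<^bsub>free_group (topspace X)\<^esub> w)"
      using topological_group_free_topology[of X] by (simp add: topological_group_def)
    from continuous_map_compose[OF gen this] show ?thesis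
    proof (rule continuous_map_eq)
      fix y assume "y \<in> topspace Y"
      then have "g y \<in> topspace X" using g by (auto simp: continuous_map_def)
      then show "((\<lambda>w. inv\<^bsub>free_group (topspace X)\<^esub> w) \<circ> (generator \<circ> g)) y = [(b, g y)]"
        by (simp add: inv_generator False)
    qed
  qed
  from continuous_map_free_group_mult[OF this f] show ?thesis by simp
qed

lemma continuous_map_Nil: "continuous_map Y (free_topology X) (\<lambda>y. [])"
  by (auto simp: topspace_free_topology carrier_free_group)

text \<open>The universal property only supplies some continuous homomorphism; its uniqueness clause
  identifies that one with the explicit \<open>word_eval\<close>, which can be computed.\<close>

lemma continuous_map_word_eval:
  assumes G: "topological_group G S" and f: "continuous_map X S f"
  shows "continuous_map (free_topology X) S (word_eval G f)"
proof -
  have grp: "group G" and im: "f ` topspace X \<subseteq> carrier G"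
    using assms by (auto simp: topological_group_def continuous_map_def)
  obtain h where h: "h \<in> hom (free_group (topspace X)) G" "continuous_map (free_topology X) S h"
      "\<forall>x\<in>topspace X. h (generator x) = f x"
    using free_topology_universal(1)[OF G f] by blast
  have "h w = word_eval G f w" if "w \<in> topspace (free_topology X)" for w
    using free_topology_universal(2)[OF G f h(1) word_eval_hom[OF grp im] _, of w] that h(3)
    by (auto simp: topspace_free_topology word_eval_generator[OF grp im])
  with h(2) show ?thesis by (rule continuous_map_eq)
qed

text \<open>Cancellation does not change the value, so explicit words can be evaluated as spelled,
  without deciding which letters cancel.\<close>

lemma word_eval_reduce:
  assumes "group G" "f ` A \<subseteq> carrier G" "set u \<subseteq> UNIV \<times> A"
  shows "word_eval G f (foldr push u []) = word_eval G f u"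
proof -
  interpret group G by (rule assms(1))
  show ?thesis
    using word_eval_foldr_push[OF assms(1-3), of "[]"] word_eval_closed[OF assms(1-3)] by simp
qed

section \<open>Homomorphisms to the Heisenberg group\<close>

text \<open>Triples encode real upper unitriangular 3 by 3 matrices: \<open>a\<close> and
  \<open>b\<close> stand next to the diagonal, \<open>c\<close> in the corner.\<close>

definition heisenberg :: "(real \<times> real \<times> real) monoid" where
  "heisenberg = \<lparr>carrier = UNIV,
     mult = (\<lambda>(a, b, c) (a', b', c'). (a + a', b + b', c + c' + a * b')), one = (0, 0, 0)\<rparr>"

lemma heisenberg_simps [simp]:
  "carrier heisenberg = UNIV" "\<one>\<^bsub>heisenberg\<^esub> = (0, 0, 0)"
  "(a, b, c) \<otimes>\<^bsub>heisenberg\<^esub> (a', b', c') = (a + a', b + b', c + c' + a * b')"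
  by (simp_all add: heisenberg_def)

lemma group_heisenberg: "group heisenberg"
proof (rule groupI)
  fix x assume "x \<in> carrier heisenberg"
  obtain a b c where "x = (a, b, c)" by (cases x)
  then show "\<exists>y\<in>carrier heisenberg. y \<otimes>\<^bsub>heisenberg\<^esub> x = \<one>\<^bsub>heisenberg\<^esub>"
    by (intro bexI[of _ "(- a, - b, a * b - c)"]) auto
qed (auto simp: algebra_simps)

lemma inv_heisenberg [simp]: "inv\<^bsub>heisenberg\<^esub> (a, b, c) = (- a, - b, a * b - c)"
  by (rule group.inv_equality[OF group_heisenberg]) auto

lemma topological_group_heisenberg: "topological_group heisenberg euclidean"
proof -
  have "inv\<^bsub>heisenberg\<^esub> x = (- fst x, - fst (snd x), fst x * fst (snd x) - snd (snd x))" for x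
    by (cases x) simp
  moreover have "x \<otimes>\<^bsub>heisenberg\<^esub> y =
      (fst x + fst y, fst (snd x) + fst (snd y), snd (snd x) + snd (snd y) + fst x * fst (snd y))" for x y
    by (cases x; cases y) simp
  ultimately show ?thesis
    by (auto simp: topological_group_def group_heisenberg case_prod_unfold
        euclidean_product_topology intro!: continuous_intros)
qed

abbreviation heis :: "('a \<Rightarrow> real) \<Rightarrow> ('a \<Rightarrow> real) \<Rightarrow> 'a word \<Rightarrow> real \<times> real \<times> real" where
  "heis \<phi> \<psi> \<equiv> word_eval heisenberg (\<lambda>x. (\<phi> x, \<psi> x, 0))"

lemma continuous_map_heis:
  assumes "continuous_map X euclideanreal \<phi>" "continuous_map X euclideanreal \<psi>"
  shows "continuous_map (free_topology X) euclideanreal (\<lambda>w. fst (heis \<phi> \<psi> w))"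
    and "continuous_map (free_topology X) euclideanreal (\<lambda>w. snd (snd (heis \<phi> \<psi> w)))"
proof -
  have "continuous_map X (prod_topology euclideanreal (prod_topology euclideanreal euclideanreal))
          (\<lambda>x. (\<phi> x, \<psi> x, 0))"
    by (intro continuous_map_pairedI assms) auto
  then have "continuous_map X euclidean (\<lambda>x. (\<phi> x, \<psi> x, 0::real))"
    by (simp add: euclidean_product_topology)
  then have *: "continuous_map (free_topology X) euclidean (heis \<phi> \<psi>)"
    by (rule continuous_map_word_eval[OF topological_group_heisenberg])
  have "continuous_map euclidean euclideanreal (fst :: real \<times> real \<times> real \<Rightarrow> real)"
    "continuous_map euclidean euclideanreal (\<lambda>z. snd (snd (z :: real \<times> real \<times> real)))"
    by (auto intro!: continuous_intros)
  from continuous_map_compose[OF * this(1)] continuous_map_compose[OF * this(2)]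
  show "continuous_map (free_topology X) euclideanreal (\<lambda>w. fst (heis \<phi> \<psi> w))"
    and "continuous_map (free_topology X) euclideanreal (\<lambda>w. snd (snd (heis \<phi> \<psi> w)))"
    by (simp_all add: o_def)
qed

text \<open>The middle coordinate depends on \<open>\<psi>\<close> alone, so the recursions for the
  first coordinate and for the corner are linear in \<open>\<phi>\<close>. Only the values of
  \<open>\<phi>\<close> at the letters of \<open>w\<close> enter.\<close>

lemma heis_linear:
  assumes "\<And>x. x \<in> snd ` set w \<Longrightarrow> \<phi> x = (\<Sum>i\<in>I. t i * \<eta> i x)"
  shows "fst (heis \<phi> \<psi> w) = (\<Sum>i\<in>I. t i * fst (heis (\<eta> i) \<psi> w))"
    and "snd (snd (heis \<phi> \<psi> w)) = (\<Sum>i\<in>I. t i * snd (snd (heis (\<eta> i) \<psi> w)))"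
proof -
  define f where "f u = fst (snd (heis (\<lambda>_. 0) \<psi> u))" for u
  have f: "fst (snd (heis \<phi> \<psi> u)) = f u" for \<phi> u
  proof (induction u)
    case (Cons a u)
    then show ?case
      by (cases "heis \<phi> \<psi> u"; cases "heis (\<lambda>_. 0) \<psi> u") (simp add: f_def)
  qed (simp add: f_def)
  have step: "heis \<phi> \<psi> (a # u) =
     (if fst a then (\<phi> (snd a) + fst (heis \<phi> \<psi> u), \<psi> (snd a) + f u, snd (snd (heis \<phi> \<psi> u)) + \<phi> (snd a) * f u)
      else (fst (heis \<phi> \<psi> u) - \<phi> (snd a), f u - \<psi> (snd a),
            \<phi> (snd a) * \<psi> (snd a) + snd (snd (heis \<phi> \<psi> u)) - \<phi> (snd a) * f u))" for \<phi> a u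
    using f[of \<phi> u] by (cases "heis \<phi> \<psi> u") simp
  have "fst (heis \<phi> \<psi> w) = (\<Sum>i\<in>I. t i * fst (heis (\<eta> i) \<psi> w)) \<and>
        snd (snd (heis \<phi> \<psi> w)) = (\<Sum>i\<in>I. t i * snd (snd (heis (\<eta> i) \<psi> w)))"
    using assms
  proof (induction w)
    case (Cons a w)
    then have "\<phi> (snd a) = (\<Sum>i\<in>I. t i * \<eta> i (snd a))" by auto
    with Cons show ?case
      unfolding step
      by (auto simp: sum_distrib_right sum_distrib_left sum.distrib sum_subtractf algebra_simps)
  qed simp
  then show "fst (heis \<phi> \<psi> w) = (\<Sum>i\<in>I. t i * fst (heis (\<eta> i) \<psi> w))"
    and "snd (snd (heis \<phi> \<psi> w)) = (\<Sum>i\<in>I. t i * snd (snd (heis (\<eta> i) \<psi> w)))"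
    by blast+
qed

section \<open>Supports of compact sets of words\<close>

text \<open>Gliding hump. Infinitely many active indices would yield pairs \<open>(a n, s n)\<close>
  with \<open>c (a n)\<close> nonzero at \<open>s n\<close> and zero at all earlier points. Solving
  a triangular system for the coefficients then makes the combination equal to \<open>n\<close> at
  \<open>s n\<close>, hence unbounded.\<close>

lemma finite_nonzero_if_all_combinations_bounded:
  fixes c :: "'i \<Rightarrow> 's \<Rightarrow> real"
  assumes fin: "\<And>s. s \<in> S \<Longrightarrow> finite {i\<in>A. c i s \<noteq> 0}"
    and bdd: "\<And>t. \<exists>b. \<forall>s\<in>S. (\<Sum>i | i \<in> A \<and> c i s \<noteq> 0. t i * c i s) \<le> b"
  shows "finite {i\<in>A. \<exists>s\<in>S. c i s \<noteq> 0}"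
proof (rule ccontr)
  let ?B = "{i\<in>A. \<exists>s\<in>S. c i s \<noteq> 0}"
  assume inf: "infinite ?B"
  \<comment> \<open>The guard \<open>snd (f m) \<in> S\<close> is there because the choice principle
    supplies an arbitrary history \<open>f\<close>; it keeps the excluded set \<open>?Z\<close>
    finite.\<close>
  let ?P = "\<lambda>(f :: nat \<Rightarrow> 'i \<times> 's) n r. fst r \<in> A \<and> snd r \<in> S \<and> c (fst r) (snd r) \<noteq> 0 \<and>
              (\<forall>m<n. snd (f m) \<in> S \<longrightarrow> c (fst r) (snd (f m)) = 0)"
  have "\<exists>f. \<forall>n. ?P f n (f n)"
  proof (rule dependent_wf_choice[where R = less_than and P = ?P])
    fix n :: nat and f :: "nat \<Rightarrow> 'i \<times> 's"
    let ?Z = "\<Union>m\<in>{m. m < n \<and> snd (f m) \<in> S}. {i\<in>A. c i (snd (f m)) \<noteq> 0}"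
    have "finite ?Z" using fin by auto
    then have "infinite (?B - ?Z)" using inf by simp
    then have "?B - ?Z \<noteq> {}" by (rule infinite_imp_nonempty)
    then obtain i where "i \<in> ?B" "i \<notin> ?Z" by blast
    then obtain s where "i \<in> A" "s \<in> S" "c i s \<noteq> 0" by blast
    then have "?P f n (i, s)" using \<open>i \<notin> ?Z\<close> by auto
    then show "\<exists>r. ?P f n r" by blast
  qed auto
  then obtain f where f: "\<And>n. ?P f n (f n)" by blast
  define a where "a n = fst (f n)" for n
  define s where "s n = snd (f n)" for n
  have as: "a n \<in> A" "s n \<in> S" "c (a n) (s n) \<noteq> 0" for n
    using f[of n] by (auto simp: a_def s_def)
  have tri: "c (a n) (s m) = 0" if "m < n" for m n
    using f[of n] f[of m] that by (auto simp: a_def s_def)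
  have inj: "inj a"
  proof (rule linorder_injI)
    fix m n :: nat assume "m < n"
    then show "a m \<noteq> a n" using as(3)[of m] tri[of m n] by metis
  qed
  have "\<exists>\<tau>. \<forall>n. \<tau> n = (real n - (\<Sum>m<n. \<tau> m * c (a m) (s n))) / c (a n) (s n)"
    by (rule dependent_wf_choice[where R = less_than and
          P = "\<lambda>\<tau> n r. r = (real n - (\<Sum>m<n. \<tau> m * c (a m) (s n))) / c (a n) (s n)"]) auto
  then obtain \<tau> where \<tau>: "\<And>n. \<tau> n = (real n - (\<Sum>m<n. \<tau> m * c (a m) (s n))) / c (a n) (s n)"
    by blast
  define t where "t i = (if i \<in> range a then \<tau> (inv_into UNIV a i) else 0)" for i
  have t: "t (a n) = \<tau> n" for n using inj by (simp add: t_def)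
  have "(\<Sum>i | i \<in> A \<and> c i (s n) \<noteq> 0. t i * c i (s n)) = real n" for n
  proof -
    have "(\<Sum>i | i \<in> A \<and> c i (s n) \<noteq> 0. t i * c i (s n)) = (\<Sum>i\<in>a ` {..n}. t i * c i (s n))"
    proof (rule sum.mono_neutral_cong)
      show "finite {i. i \<in> A \<and> c i (s n) \<noteq> 0}" using fin[OF as(2)] by simp
      show "t i * c i (s n) = 0" if i: "i \<in> {i. i \<in> A \<and> c i (s n) \<noteq> 0} - a ` {..n}" for i
      proof (cases "i \<in> range a")
        case True
        then obtain m where m: "i = a m" by blast
        with i have "\<not> m \<le> n" by blast
        then show ?thesis using tri[of n m] by (simp add: m)
      qed (simp add: t_def)
      show "t i * c i (s n) = 0" if i: "i \<in> a ` {..n} - {i. i \<in> A \<and> c i (s n) \<noteq> 0}" for i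
      proof -
        have "i \<in> A" using i as(1) by blast
        with i show ?thesis by simp
      qed
    qed simp_all
    also have "\<dots> = (\<Sum>m\<le>n. \<tau> m * c (a m) (s n))"
      using inj by (subst sum.reindex) (auto simp: t inj_on_def)
    also have "\<dots> = (\<Sum>m<n. \<tau> m * c (a m) (s n)) + \<tau> n * c (a n) (s n)"
      by (simp add: lessThan_Suc_atMost[symmetric])
    also have "\<dots> = real n"
      using as(3)[of n] by (subst (2) \<tau>) simp
    finally show ?thesis .
  qed
  moreover obtain b where "\<forall>s\<in>S. (\<Sum>i | i \<in> A \<and> c i s \<noteq> 0. t i * c i s) \<le> b"
    using bdd by blast
  ultimately have "real n \<le> b" for n using as(2)[of n] by metis
  then show False by (meson reals_Archimedean2 not_le)
qed

definition locally_finite_functions :: "'a topology \<Rightarrow> 'i set \<Rightarrow> ('i \<Rightarrow> 'a \<Rightarrow> real) \<Rightarrow> bool" where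
  "locally_finite_functions X A \<eta> \<longleftrightarrow>
     (\<forall>i\<in>A. continuous_map X euclideanreal (\<eta> i)) \<and>
     (\<forall>x\<in>topspace X. \<exists>U. openin X U \<and> x \<in> U \<and> finite {i\<in>A. \<exists>y\<in>U. \<eta> i y \<noteq> 0})"

lemma locally_finite_functions_continuous:
  "locally_finite_functions X A \<eta> \<Longrightarrow> i \<in> A \<Longrightarrow> continuous_map X euclideanreal (\<eta> i)"
  by (simp add: locally_finite_functions_def)

lemma locally_finite_functions_nbhd:
  assumes "locally_finite_functions X A \<eta>" "x \<in> topspace X"
  shows "\<exists>U. openin X U \<and> x \<in> U \<and> finite {i\<in>A. \<exists>y\<in>U. \<eta> i y \<noteq> 0}"
  by (rule bspec[OF conjunct2[OF assms(1)[unfolded locally_finite_functions_def]] assms(2)])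

lemma locally_finite_functions_point:
  assumes "locally_finite_functions X A \<eta>" "x \<in> topspace X"
  shows "finite {i\<in>A. \<eta> i x \<noteq> 0}"
proof -
  obtain U where "x \<in> U" and U: "finite {i\<in>A. \<exists>y\<in>U. \<eta> i y \<noteq> 0}"
    using locally_finite_functions_nbhd[OF assms] by (elim exE conjE)
  from U show ?thesis by (rule rev_finite_subset) (use \<open>x \<in> U\<close> in blast)
qed

text \<open>Near each point only finitely many \<open>\<eta> i\<close> are nonzero, so the sum is
  locally one fixed finite sum; the pasting lemma glues these.\<close>

lemma continuous_map_locally_finite_sum:
  assumes "locally_finite_functions X A \<eta>"
  shows "continuous_map X euclideanreal (\<lambda>x. \<Sum>i | i \<in> A \<and> \<eta> i x \<noteq> 0. t i * \<eta> i x)"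
proof -
  define U where "U x = (SOME U. openin X U \<and> x \<in> U \<and> finite {i\<in>A. \<exists>y\<in>U. \<eta> i y \<noteq> 0})" for x
  have U: "openin X (U x)" "x \<in> U x" "finite {i\<in>A. \<exists>y\<in>U x. \<eta> i y \<noteq> 0}" if "x \<in> topspace X" for x
    using someI_ex[OF locally_finite_functions_nbhd[OF assms that]] by (simp_all only: U_def)
  let ?f = "\<lambda>x y. \<Sum>i\<in>{i\<in>A. \<exists>y\<in>U x. \<eta> i y \<noteq> 0}. t i * \<eta> i y"
  have f: "(\<Sum>i | i \<in> A \<and> \<eta> i y \<noteq> 0. t i * \<eta> i y) = ?f x y" if "x \<in> topspace X" "y \<in> U x" for x y
    by (rule sum.mono_neutral_left) (use U(3)[OF that(1)] that in auto)
  show ?thesis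
  proof (rule pasting_lemma[where I = "topspace X" and T = U and f = ?f])
    fix x assume x: "x \<in> topspace X"
    show "continuous_map (subtopology X (U x)) euclideanreal (?f x)"
      using U(3)[OF x]
      by (intro continuous_map_from_subtopology continuous_map_sum continuous_map_real_mult_left
          locally_finite_functions_continuous[OF assms]) simp_all
  next
    fix x z y assume "x \<in> topspace X" "z \<in> topspace X" "y \<in> topspace X \<inter> U x \<inter> U z"
    then show "?f x y = ?f z y" using f[of x y] f[of z y] by simp
  next
    fix x assume "x \<in> topspace X"
    then show "\<exists>j. j \<in> topspace X \<and> x \<in> U j \<and> (\<Sum>i | i \<in> A \<and> \<eta> i x \<noteq> 0. t i * \<eta> i x) = ?f j x"
      using f[of x x] U(2) by blast
  qed (rule U(1))
qed

text \<open>A compact set of words involves only finitely many members of a locally finite family of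
  functions: otherwise some linear combination of the family would induce an unbounded function
  on it.\<close>

lemma compactin_free_topology_finite_support:
  fixes c :: "('a \<Rightarrow> real) \<Rightarrow> 'a word \<Rightarrow> real"
  assumes \<eta>: "locally_finite_functions X A \<eta>" and K: "compactin (free_topology X) K"
    and cont: "\<And>\<phi>. continuous_map X euclideanreal \<phi> \<Longrightarrow>
                 continuous_map (free_topology X) euclideanreal (c \<phi>)"
    and lin: "\<And>\<phi> I (t :: 'i \<Rightarrow> real) w. (\<And>x. x \<in> snd ` set w \<Longrightarrow> \<phi> x = (\<Sum>i\<in>I. t i * \<eta> i x)) \<Longrightarrow>
                 c \<phi> w = (\<Sum>i\<in>I. t i * c (\<eta> i) w)"
  shows "finite {i\<in>A. \<exists>w\<in>K. c (\<eta> i) w \<noteq> 0}"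
proof (rule finite_nonzero_if_all_combinations_bounded)
  let ?N = "\<lambda>w. \<Union>x\<in>snd ` set w. {i\<in>A. \<eta> i x \<noteq> 0}"
  have letters: "snd ` set w \<subseteq> topspace X" if "w \<in> K" for w
    using compactin_subset_topspace[OF K] that by (force simp: topspace_free_topology carrier_free_group)
  have N: "finite (?N w)" if "w \<in> K" for w
    using letters[OF that] locally_finite_functions_point[OF \<eta>] by auto
  have sub: "{i\<in>A. c (\<eta> i) w \<noteq> 0} \<subseteq> ?N w" for w
  proof (rule subsetI, rule ccontr)
    fix i assume i: "i \<in> {i\<in>A. c (\<eta> i) w \<noteq> 0}" "i \<notin> ?N w"
    then have "c (\<eta> i) w = (\<Sum>j\<in>{}. 0 * c (\<eta> j) w)"
      by (intro lin) auto
    with i show False by simp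
  qed
  show "finite {i\<in>A. c (\<eta> i) w \<noteq> 0}" if "w \<in> K" for w
    using finite_subset[OF sub N[OF that]] .
  fix t :: "'i \<Rightarrow> real"
  let ?\<phi> = "\<lambda>x. \<Sum>i | i \<in> A \<and> \<eta> i x \<noteq> 0. t i * \<eta> i x"
  have eq: "(\<Sum>i | i \<in> A \<and> c (\<eta> i) w \<noteq> 0. t i * c (\<eta> i) w) = c ?\<phi> w" if w: "w \<in> K" for w
  proof -
    have "c ?\<phi> w = (\<Sum>i\<in>?N w. t i * c (\<eta> i) w)"
      by (rule lin, rule sum.mono_neutral_left) (use N[OF w] in auto)
    then show ?thesis
      using sum.mono_neutral_left[OF N[OF w] sub, of "\<lambda>i. t i * c (\<eta> i) w"] by simp
  qed
  have "compactin euclideanreal (c ?\<phi> ` K)"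
    by (rule image_compactin[OF K cont[OF continuous_map_locally_finite_sum[OF \<eta>]]])
  then have "bdd_above (c ?\<phi> ` K)"
    by (simp add: compact_imp_bounded bounded_imp_bdd_above)
  then show "\<exists>b. \<forall>w\<in>K. (\<Sum>i | i \<in> A \<and> c (\<eta> i) w \<noteq> 0. t i * c (\<eta> i) w) \<le> b"
    using eq by (auto simp: bdd_above_def)
qed

section \<open>Functions that are continuous on compact sets only\<close>

text \<open>The sum of the \<open>c j\<close>, each scaled to be 1 at \<open>h j\<close>, is a
  finite sum on every compact set and hence continuous there. By \<open>kR\<close> it is continuous,
  but it is 0 at \<open>e\<close> and at least 1 at every \<open>h j\<close>, while the
  \<open>h j\<close> accumulate at \<open>e\<close>.\<close>

lemma compactly_continuous_sum_contradiction:
  fixes c :: "'j \<Rightarrow> 'b \<Rightarrow> real"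
  assumes kR: "\<And>f :: 'b \<Rightarrow> real. (\<And>K. compactin T K \<Longrightarrow> continuous_map (subtopology T K) euclideanreal f) \<Longrightarrow>
                 continuous_map T euclideanreal f"
    and cont: "\<And>j. j \<in> J \<Longrightarrow> continuous_map T euclideanreal (c j)"
    and fin: "\<And>K. compactin T K \<Longrightarrow> finite {j\<in>J. \<exists>w\<in>K. c j w \<noteq> 0}"
    and nonneg: "\<And>j w. j \<in> J \<Longrightarrow> c j w \<ge> 0"
    and e: "e \<in> topspace T" "\<And>j. j \<in> J \<Longrightarrow> c j e = 0"
    and h: "\<And>j. j \<in> J \<Longrightarrow> h j \<in> topspace T" "\<And>j. j \<in> J \<Longrightarrow> c j (h j) > 0"
    and dense: "\<And>U. openin T U \<Longrightarrow> e \<in> U \<Longrightarrow> \<exists>j\<in>J. h j \<in> U"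
  shows False
proof -
  define f where "f w = (\<Sum>j | j \<in> J \<and> c j w \<noteq> 0. c j w / c j (h j))" for w
  have fin1: "finite {j\<in>J. c j w \<noteq> 0}" if "w \<in> topspace T" for w
    using fin[of "{w}"] that by simp
  have "continuous_map T euclideanreal f"
  proof (rule kR)
    fix K assume K: "compactin T K"
    let ?JK = "{j\<in>J. \<exists>w\<in>K. c j w \<noteq> 0}"
    have "continuous_map (subtopology T K) euclideanreal (\<lambda>w. \<Sum>j\<in>?JK. c j w / c j (h j))"
      using fin[OF K] h(2) cont
      by (intro continuous_map_sum continuous_map_real_divide continuous_map_from_subtopology)
         (auto simp: less_imp_neq[THEN not_sym])
    moreover have "(\<Sum>j\<in>?JK. c j w / c j (h j)) = f w" if "w \<in> topspace (subtopology T K)" for w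
      unfolding f_def by (rule sum.mono_neutral_right) (use fin[OF K] that in auto)
    ultimately show "continuous_map (subtopology T K) euclideanreal f"
      by (rule continuous_map_eq)
  qed
  then have "openin T {w \<in> topspace T. f w \<in> {..<1}}"
    by (rule openin_continuous_map_preimage) simp
  moreover have "e \<in> {w \<in> topspace T. f w \<in> {..<1}}"
    using e by (auto simp: f_def intro!: le_less_trans[OF eq_refl zero_less_one] sum.neutral)
  ultimately obtain j where j: "j \<in> J" "h j \<in> topspace T" "f (h j) < 1"
    using dense by blast
  have ne: "c j (h j) \<noteq> 0" using h(2)[OF j(1)] by simp
  have "f (h j) \<ge> (\<Sum>i\<in>{j}. c i (h j) / c i (h i))"
    unfolding f_def
    by (rule sum_mono2) (use fin1[OF j(2)] j(1) ne h(2) nonneg in \<open>auto simp: less_imp_le\<close>)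
  with j ne show False by simp
qed

lemma openin_mult_nbhd:
  assumes "openin (free_topology X) V" "[] \<in> V"
  obtains W where "openin (free_topology X) W" "[] \<in> W"
    "\<And>u v. u \<in> W \<Longrightarrow> v \<in> W \<Longrightarrow> foldr push u v \<in> V"
proof -
  let ?F = "free_topology X"
  define P where "P = {z \<in> topspace (prod_topology ?F ?F). (case z of (u, v) \<Rightarrow> foldr push u v) \<in> V}"
  have P: "openin (prod_topology ?F ?F) P"
    unfolding P_def by (rule openin_continuous_map_preimage[OF continuous_map_foldr_push assms(1)])
  have "([], []) \<in> P"
    using assms by (auto simp: P_def topspace_free_topology carrier_free_group)
  from P[unfolded openin_prod_topology_alt, rule_format, OF this]
  obtain A B where AB: "openin ?F A" "openin ?F B" "[] \<in> A" "[] \<in> B" "A \<times> B \<subseteq> P"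
    by (elim exE conjE)
  show ?thesis
  proof (rule that[of "A \<inter> B"])
    show "foldr push u v \<in> V" if "u \<in> A \<inter> B" "v \<in> A \<inter> B" for u v
      using subsetD[OF AB(5), of "(u, v)"] that by (simp add: P_def)
  qed (use AB in \<open>simp_all add: openin_Int\<close>)
qed

text \<open>Cardinals are comparable: either all of \<open>D\<close> injects into the power set of
  the naturals, or that power set injects into \<open>D\<close> and its image is uncountable by
  Cantor's theorem.\<close>

lemma uncountable_subset_inj_nat_set:
  assumes "uncountable D"
  obtains D' and g :: "'a \<Rightarrow> nat set" where "D' \<subseteq> D" "uncountable D'" "inj_on g D'"
proof -
  have "(\<exists>g. inj_on g D \<and> g ` D \<subseteq> (UNIV :: nat set set)) \<or> (\<exists>f :: nat set \<Rightarrow> 'a. inj f \<and> range f \<subseteq> D)"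
    unfolding card_of_ordLeq by (intro ordLeq_total card_of_Well_order)
  then show ?thesis
  proof (elim disjE exE conjE)
    fix g :: "'a \<Rightarrow> nat set" assume "inj_on g D"
    with assms show ?thesis by (intro that[of D g]) auto
  next
    fix f :: "nat set \<Rightarrow> 'a" assume f: "inj f" "range f \<subseteq> D"
    have "uncountable (UNIV :: nat set set)"
    proof
      assume "countable (UNIV :: nat set set)"
      then have "range (from_nat_into (UNIV :: nat set set)) = Pow UNIV"
        by (simp add: range_from_nat_into)
      then show False using Cantors_theorem by blast
    qed
    with f show ?thesis
      by (intro that[of "range f" "inv_into UNIV f"]) (auto simp: countable_image_inj_eq inj_on_inv_into)
  qed
qed

text \<open>Pigeonhole: below \<open>k\<close> only finitely many traces are possible, so two
  members of the infinite set agree there.\<close>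

lemma first_difference_unbounded:
  fixes g :: "'a \<Rightarrow> nat set"
  assumes "infinite S" "inj_on g S"
  obtains x y where "x \<in> S" "y \<in> S" "x \<noteq> y" "k \<le> (LEAST n. (n \<in> g x) \<noteq> (n \<in> g y))"
proof -
  have "finite ((\<lambda>x. g x \<inter> {..<k}) ` S)"
    by (rule finite_subset[of _ "Pow {..<k}"]) auto
  with assms(1) have "\<not> inj_on (\<lambda>x. g x \<inter> {..<k}) S"
    using finite_imageD by blast
  then obtain x y where xy: "x \<in> S" "y \<in> S" "x \<noteq> y" "g x \<inter> {..<k} = g y \<inter> {..<k}"
    by (auto simp: inj_on_def)
  then have "g x \<noteq> g y" using assms(2) by (auto simp: inj_on_def)
  then have "\<exists>n. (n \<in> g x) \<noteq> (n \<in> g y)" by blast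
  from LeastI_ex[OF this] have "\<not> (LEAST n. (n \<in> g x) \<noteq> (n \<in> g y)) < k"
    using xy(4) by (auto simp: set_eq_iff)
  with xy show ?thesis using that by (simp add: not_less)
qed

section \<open>Test words and their Heisenberg coordinates\<close>

lemma finite_heis_support:
  assumes "locally_finite_functions X A \<eta>" "continuous_map X euclideanreal \<psi>"
    and "compactin (free_topology X) K"
  shows "finite {i\<in>A. \<exists>w\<in>K. fst (heis (\<eta> i) \<psi> w) \<noteq> 0}"
    and "finite {i\<in>A. \<exists>w\<in>K. snd (snd (heis (\<eta> i) \<psi> w)) \<noteq> 0}"
proof -
  show "finite {i\<in>A. \<exists>w\<in>K. fst (heis (\<eta> i) \<psi> w) \<noteq> 0}"
    by (rule compactin_free_topology_finite_support[OF assms(1,3), where c = "\<lambda>\<phi> w. fst (heis \<phi> \<psi> w)"])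
       (rule continuous_map_heis[OF _ assms(2)] heis_linear; assumption)+
  show "finite {i\<in>A. \<exists>w\<in>K. snd (snd (heis (\<eta> i) \<psi> w)) \<noteq> 0}"
    by (rule compactin_free_topology_finite_support[OF assms(1,3), where c = "\<lambda>\<phi> w. snd (snd (heis \<phi> \<psi> w))"])
       (rule continuous_map_heis[OF _ assms(2)] heis_linear; assumption)+
qed

lemma heis_reduce: "heis \<phi> \<psi> (foldr push u []) = heis \<phi> \<psi> u"
  by (rule word_eval_reduce[OF group_heisenberg, of _ UNIV]) auto

text \<open>The conjugate of \<open>x p^-1\<close> by \<open>d\<close>. It cancels completely at
  \<open>x = p\<close>, so it tends to the identity as \<open>x\<close> tends to \<open>p\<close>,
  at a rate that may depend on \<open>d\<close>.\<close>

abbreviation conj_word :: "'a \<Rightarrow> 'a \<Rightarrow> 'a \<Rightarrow> 'a word" where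
  "conj_word d x p \<equiv> [(True, d), (True, x), (False, p), (False, d)]"

text \<open>If \<open>\<phi>\<close> vanishes at \<open>p\<close> and \<open>x\<close>, and
  \<open>\<psi>\<close> at \<open>p\<close>, then \<open>conj_word d x p\<close> has coordinates
  \<open>(0, \<psi> x, \<psi> x * \<phi> d)\<close>; multiplying by \<open>a p^-1\<close> on the
  left adds \<open>\<psi> x * \<phi> a\<close> to the corner. In the first coordinate the two
  occurrences of \<open>d\<close> cancel.\<close>

lemma heis_conj_word:
  assumes "\<phi> p = 0" "\<phi> x = 0" "\<psi> p = 0"
  shows "snd (snd (heis \<phi> \<psi> (conj_word d x p @ conj_word d' x p))) = \<psi> x * (\<phi> d + \<phi> d')"
    and "snd (snd (heis \<phi> \<psi> ([(True, a), (False, p)] @ conj_word d x p))) = \<psi> x * (\<phi> d + \<phi> a)"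
    and "fst (heis \<eta> \<psi> ([(True, a), (False, p)] @ conj_word d x p)) = \<eta> a + \<eta> x - 2 * \<eta> p"
  using assms by (simp_all add: algebra_simps)

lemma continuous_map_conj_word:
  assumes "d \<in> topspace X" "p \<in> topspace X"
  shows "continuous_map X (free_topology X) (\<lambda>x. foldr push (conj_word d x p) [])"
  by (simp only: foldr.simps o_apply id_apply, (rule continuous_map_push)+, rule continuous_map_Nil)
    (use assms in simp_all)

lemma conj_word_eventually:
  assumes "d \<in> topspace X" "p \<in> topspace X" "openin (free_topology X) W" "[] \<in> W"
    and lim: "\<And>U. openin X U \<Longrightarrow> p \<in> U \<Longrightarrow> \<exists>N. \<forall>n\<ge>N. x n \<in> U"
  shows "\<exists>N. \<forall>n\<ge>N. foldr push (conj_word d (x n) p) [] \<in> W"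
proof -
  let ?P = "{y \<in> topspace X. foldr push (conj_word d y p) [] \<in> W}"
  have P: "openin X ?P"
    by (rule openin_continuous_map_preimage[OF continuous_map_conj_word assms(3)]) (rule assms)+
  have "p \<in> ?P"
    using assms(2,4) by (simp add: inv_letter_def)
  from lim[OF P this] obtain N where N: "\<forall>n\<ge>N. x n \<in> ?P"
    by (elim exE)
  show ?thesis
    by (intro exI[of _ N] allI impI) (use N in \<open>simp only: mem_Collect_eq\<close>)
qed

section \<open>The two families of words that contradict continuity\<close>

text \<open>A compact set is seen by \<open>t a\<close> for only finitely many \<open>a\<close>,
  hence by finitely many pairs. For accumulation at the identity, each \<open>a\<close> has a
  threshold beyond which its conjugates are close; some threshold \<open>k\<close> is shared by
  infinitely many \<open>a\<close>, and two of these have codes that first differ at or after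
  \<open>k\<close>, so both factors are close.\<close>

lemma not_kR_uncountable_family:
  fixes X :: "'a topology" and Z :: "'a word set" and x :: "nat \<Rightarrow> 'a"
  defines "T \<equiv> subtopology (free_topology X) Z"
  assumes kR: "\<And>f :: 'a word \<Rightarrow> real.
        (\<And>K. compactin T K \<Longrightarrow> continuous_map (subtopology T K) euclideanreal f) \<Longrightarrow>
        continuous_map T euclideanreal f"
    and Z: "\<And>w. w \<in> carrier (free_group (topspace X)) \<Longrightarrow> length w \<le> 8 \<Longrightarrow> w \<in> Z"
    and p: "p \<in> topspace X" and x: "\<And>n. x n \<in> topspace X"
    and lim: "\<And>U. openin X U \<Longrightarrow> p \<in> U \<Longrightarrow> \<exists>N. \<forall>n\<ge>N. x n \<in> U"
    and \<psi>: "continuous_map X euclideanreal \<psi>" "\<psi> p = 0" "\<And>n. \<psi> (x n) > 0"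
    and D: "D \<subseteq> topspace X" "uncountable D"
    and \<eta>: "locally_finite_functions X D \<eta>" "\<And>d. d \<in> D \<Longrightarrow> \<eta> d d = 1" "\<And>d y. \<eta> d y \<ge> 0"
      "\<And>d. d \<in> D \<Longrightarrow> \<eta> d p = 0" "\<And>d n. d \<in> D \<Longrightarrow> \<eta> d (x n) = 0"
  shows False
proof -
  obtain D' and g :: "'a \<Rightarrow> nat set" where D': "D' \<subseteq> D" "uncountable D'" "inj_on g D'"
    using uncountable_subset_inj_nat_set[OF D(2)] .
  define e where "e a b = (LEAST n. (n \<in> g a) \<noteq> (n \<in> g b))" for a b
  define J where "J = {(a, b). a \<in> D' \<and> b \<in> D' \<and> a \<noteq> b}"
  \<comment> \<open>Both factors use the index \<open>e a b\<close> where the two codes first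
    differ. Two conjugates of four letters account for the bound 8.\<close>
  define raw where "raw = (\<lambda>(a, b). conj_word a (x (e a b)) p @ conj_word b (x (e a b)) p)"
  define h where "h j = foldr push (raw j) []" for j
  define t where "t a w = snd (snd (heis (\<eta> a) \<psi> w))" for a w
  \<comment> \<open>The product is nonzero only where both \<open>t a\<close> and \<open>t b\<close>
    are, which restricts both members of the pair; the square makes it nonnegative.\<close>
  define c where "c = (\<lambda>(a, b) w. (t a w * t b w)\<^sup>2)"
  have t: "continuous_map T euclideanreal (t a)" if "a \<in> D" for a
    unfolding T_def t_def
    by (intro continuous_map_from_subtopology continuous_map_heis \<psi>
        locally_finite_functions_continuous[OF \<eta>(1)] that)
  have e_top: "[] \<in> topspace T"
    using Z[of "[]"] by (auto simp: T_def topspace_free_topology carrier_free_group)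
  have raw: "set (raw j) \<subseteq> UNIV \<times> topspace X" "length (raw j) \<le> 8" if "j \<in> J" for j
    using that D' D p x by (auto simp: raw_def J_def)
  show False
  proof (rule compactly_continuous_sum_contradiction[where T = T and J = J and c = c and e = "[]" and h = h])
    fix j assume j: "j \<in> J"
    then obtain a b where ab: "j = (a, b)" "a \<in> D" "b \<in> D" "a \<noteq> b"
      using D' by (auto simp: J_def)
    show "continuous_map T euclideanreal (c j)"
      unfolding c_def ab case_prod_conv by (intro continuous_map_real_pow continuous_map_real_mult t ab)
    show "c j w \<ge> 0" for w by (simp add: c_def ab)
    show "c j [] = 0" by (simp add: c_def ab t_def)
    show "h j \<in> topspace T"
      using Z[of "h j"] reduce_in_free_group[OF raw(1)[OF j]] raw(2)[OF j] length_foldr_push[of "raw j" "[]"]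
      by (auto simp: T_def h_def topspace_free_topology)
    have "t a (h j) > 0" "t b (h j) > 0"
      unfolding t_def h_def heis_reduce raw_def ab(1) case_prod_conv
      using ab \<eta>(2-5) \<psi>(2,3)
      by (simp_all only: heis_conj_word) (intro mult_pos_pos add_pos_nonneg add_nonneg_pos; simp)+
    then show "c j (h j) > 0" by (simp add: c_def ab)
  next
    fix K assume "compactin T K"
    then have "compactin (free_topology X) K" by (simp add: T_def compactin_subtopology)
    then have "finite {a\<in>D. \<exists>w\<in>K. t a w \<noteq> 0}"
      using finite_heis_support(2)[OF \<eta>(1) \<psi>(1)] by (simp add: t_def)
    then have "finite ({a\<in>D. \<exists>w\<in>K. t a w \<noteq> 0} \<times> {a\<in>D. \<exists>w\<in>K. t a w \<noteq> 0})" by simp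
    then show "finite {j\<in>J. \<exists>w\<in>K. c j w \<noteq> 0}"
      by (rule rev_finite_subset) (use D'(1) in \<open>fastforce simp: J_def c_def\<close>)
  next
    fix U assume U: "openin T U" "[] \<in> U"
    then obtain V where V: "openin (free_topology X) V" "U = V \<inter> Z"
      by (auto simp: T_def openin_subtopology)
    obtain W where W: "openin (free_topology X) W" "[] \<in> W"
        "\<And>u v. u \<in> W \<Longrightarrow> v \<in> W \<Longrightarrow> foldr push u v \<in> V"
      using openin_mult_nbhd V U by blast
    have "\<exists>N. \<forall>n\<ge>N. foldr push (conj_word a (x n) p) [] \<in> W" if "a \<in> D'" for a
      using conj_word_eventually[OF _ p W(1,2) lim] that D' D by blast
    then obtain N where N: "\<And>a n. a \<in> D' \<Longrightarrow> n \<ge> N a \<Longrightarrow> foldr push (conj_word a (x n) p) [] \<in> W"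
      by metis
    \<comment> \<open>Uncountably many points are spread over countably many thresholds.\<close>
    have "\<exists>k. infinite {a\<in>D'. N a = k}"
    proof (rule ccontr)
      assume "\<not> ?thesis"
      then have "countable (\<Union>k. {a\<in>D'. N a = k})" by (auto intro: countable_finite)
      moreover have "(\<Union>k. {a\<in>D'. N a = k}) = D'" by auto
      ultimately show False using D' by simp
    qed
    then obtain k where k: "infinite {a\<in>D'. N a = k}" by blast
    have "inj_on g {a\<in>D'. N a = k}" by (rule inj_on_subset[OF D'(3)]) simp
    from first_difference_unbounded[OF k this]
    obtain a b where "a \<in> {a\<in>D'. N a = k}" "b \<in> {a\<in>D'. N a = k}" "a \<noteq> b" "k \<le> e a b"
      unfolding e_def .
    then have ab: "a \<in> D'" "b \<in> D'" "a \<noteq> b" "N a = k" "N b = k" "k \<le> e a b"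
      by simp_all
    have j: "(a, b) \<in> J" using ab by (simp add: J_def)
    have "h (a, b) \<in> V"
      unfolding h_def raw_def case_prod_conv foldr_push_append_Nil
      by (rule W(3)) (use N ab in auto)
    moreover have "h (a, b) \<in> Z"
      using Z[of "h (a, b)"] reduce_in_free_group[OF raw(1)[OF j]] raw(2)[OF j] length_foldr_push[of "raw (a, b)" "[]"]
      by (auto simp: h_def)
    ultimately show "\<exists>j\<in>J. h j \<in> U" using j V by blast
  qed (use kR e_top in auto)
qed

text \<open>A neighbourhood of the identity is reached in two steps: first \<open>n\<close> with all
  \<open>a n i p^-1\<close> close at once, then \<open>i\<close>, depending on \<open>n\<close>,
  large enough for the conjugate by \<open>d n\<close>. A compact set leaves finitely many
  \<open>n\<close> through \<open>t n\<close>, and for each of them finitely many \<open>i\<close>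
  through \<open>s n i\<close>.\<close>

lemma not_kR_countable_family:
  fixes X :: "'a topology" and Z :: "'a word set" and x :: "nat \<Rightarrow> 'a" and d :: "nat \<Rightarrow> 'a"
    and a :: "nat \<Rightarrow> nat \<Rightarrow> 'a"
  defines "T \<equiv> subtopology (free_topology X) Z"
  assumes kR: "\<And>f :: 'a word \<Rightarrow> real.
        (\<And>K. compactin T K \<Longrightarrow> continuous_map (subtopology T K) euclideanreal f) \<Longrightarrow>
        continuous_map T euclideanreal f"
    and Z: "\<And>w. w \<in> carrier (free_group (topspace X)) \<Longrightarrow> length w \<le> 8 \<Longrightarrow> w \<in> Z"
    and p: "p \<in> topspace X" and x: "\<And>n. x n \<in> topspace X"
    and lim: "\<And>U. openin X U \<Longrightarrow> p \<in> U \<Longrightarrow> \<exists>N. \<forall>n\<ge>N. x n \<in> U"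
    and \<psi>: "continuous_map X euclideanreal \<psi>" "\<psi> p = 0" "\<And>n. \<psi> (x n) > 0"
    and d: "\<And>n. d n \<in> topspace X"
    and \<phi>: "locally_finite_functions X UNIV \<phi>" "\<And>n. \<phi> n (d n) = 1" "\<And>n y. \<phi> n y \<ge> 0"
      "\<And>n. \<phi> n p = 0" "\<And>n i. \<phi> n (x i) = 0"
    and a: "\<And>n i. a n i \<in> topspace X" "\<And>U. openin X U \<Longrightarrow> p \<in> U \<Longrightarrow> \<exists>n. \<forall>i. a n i \<in> U"
    and \<eta>: "\<And>n. locally_finite_functions X UNIV (\<eta> n)" "\<And>n i. \<eta> n i (a n i) = 1"
      "\<And>n i y. \<eta> n i y \<ge> 0" "\<And>n i. \<eta> n i p = 0"
  shows False
proof -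
  define raw where "raw = (\<lambda>(n, i). [(True, a n i), (False, p)] @ conj_word (d n) (x i) p)"
  define h where "h j = foldr push (raw j) []" for j
  define s where "s n i w = fst (heis (\<eta> n i) \<psi> w)" for n i w
  define t where "t n w = snd (snd (heis (\<phi> n) \<psi> w))" for n w
  define c where "c = (\<lambda>(n, i) w. (s n i w * t n w)\<^sup>2)"
  have st: "continuous_map T euclideanreal (s n i)" "continuous_map T euclideanreal (t n)" for n i
    unfolding T_def s_def t_def
    by (intro continuous_map_from_subtopology continuous_map_heis \<psi> UNIV_I
        locally_finite_functions_continuous[OF \<eta>(1)] locally_finite_functions_continuous[OF \<phi>(1)])+
  have e_top: "[] \<in> topspace T"
    using Z[of "[]"] by (auto simp: T_def topspace_free_topology carrier_free_group)
  have raw: "set (raw j) \<subseteq> UNIV \<times> topspace X" "length (raw j) \<le> 8" for j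
    using p x a(1) d by (auto simp: raw_def split: prod.splits)
  have hZ: "h j \<in> topspace T" "h j \<in> Z" for j
    using Z[of "h j"] reduce_in_free_group[OF raw(1), of j] raw(2)[of j] length_foldr_push[of "raw j" "[]"]
    by (auto simp: T_def h_def topspace_free_topology)
  show False
  proof (rule compactly_continuous_sum_contradiction[where T = T and J = UNIV and c = c and e = "[]" and h = h])
    fix j :: "nat \<times> nat"
    obtain n i where ni: "j = (n, i)" by (cases j)
    show "continuous_map T euclideanreal (c j)"
      unfolding c_def ni case_prod_conv by (intro continuous_map_real_pow continuous_map_real_mult st)
    show "c j w \<ge> 0" for w by (simp add: c_def ni)
    show "c j [] = 0" by (simp add: c_def ni t_def)
    have "s n i (h j) > 0" "t n (h j) > 0"
      unfolding s_def t_def h_def heis_reduce raw_def ni case_prod_conv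
      using \<eta>(2-4) \<phi>(2-5) \<psi>(2,3)
      by (simp_all only: heis_conj_word) (auto intro!: mult_pos_pos add_pos_nonneg)
    then show "c j (h j) > 0" by (simp add: c_def ni)
  next
    fix K assume "compactin T K"
    then have K: "compactin (free_topology X) K" by (simp add: T_def compactin_subtopology)
    have "finite {n. \<exists>w\<in>K. t n w \<noteq> 0}" "finite {i. \<exists>w\<in>K. s n i w \<noteq> 0}" for n
      using finite_heis_support(2)[OF \<phi>(1) \<psi>(1) K] finite_heis_support(1)[OF \<eta>(1) \<psi>(1) K]
      by (simp_all add: t_def s_def)
    then have "finite (SIGMA n:{n. \<exists>w\<in>K. t n w \<noteq> 0}. {i. \<exists>w\<in>K. s n i w \<noteq> 0})" by simp
    then show "finite {j\<in>UNIV. \<exists>w\<in>K. c j w \<noteq> 0}"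
      by (rule rev_finite_subset) (auto simp: c_def)
  next
    fix U assume U: "openin T U" "[] \<in> U"
    then obtain V where V: "openin (free_topology X) V" "U = V \<inter> Z"
      by (auto simp: T_def openin_subtopology)
    obtain W where W: "openin (free_topology X) W" "[] \<in> W"
        "\<And>u v. u \<in> W \<Longrightarrow> v \<in> W \<Longrightarrow> foldr push u v \<in> V"
      using openin_mult_nbhd V U by blast
    have "continuous_map X (free_topology X) (\<lambda>y. foldr push [(True, y), (False, p)] [])"
      by (simp only: foldr.simps o_apply id_apply, (rule continuous_map_push)+, rule continuous_map_Nil)
        (use p in simp_all)
    then have P: "openin X {y \<in> topspace X. foldr push [(True, y), (False, p)] [] \<in> W}"
      using W(1) by (rule openin_continuous_map_preimage)
    have "p \<in> {y \<in> topspace X. foldr push [(True, y), (False, p)] [] \<in> W}"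
      using p W by (simp add: inv_letter_def)
    from a(2)[OF P this]
    obtain n where n: "\<forall>i. a n i \<in> {y \<in> topspace X. foldr push [(True, y), (False, p)] [] \<in> W}"
      by (elim exE)
    have "\<exists>N. \<forall>m\<ge>N. foldr push (conj_word (d n) (x m) p) [] \<in> W"
      by (rule conj_word_eventually[OF d p W(1,2)]) (rule lim)
    then obtain i where i: "\<forall>m\<ge>i. foldr push (conj_word (d n) (x m) p) [] \<in> W"
      by (elim exE)
    have "h (n, i) \<in> V"
      unfolding h_def raw_def case_prod_conv foldr_push_append_Nil 
      by (rule W(3)) (use n i in \<open>simp_all only: mem_Collect_eq order_refl\<close>)
    then show "\<exists>j\<in>UNIV. h j \<in> U" using hZ V by blast
  qed (use kR e_top hZ in auto)
qed

section \<open>Metric spaces\<close>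

context Metric_space
begin

lemma continuous_map_dist: "a \<in> M \<Longrightarrow> continuous_map mtopology euclideanreal (d a)"
  using continuous_map_mdist[of mtopology Self "\<lambda>_. a" "\<lambda>y. y"]
  by (simp add: mtopology_of_def)

definition bump :: "'a \<Rightarrow> real \<Rightarrow> 'a \<Rightarrow> real" where
  "bump a r y = max 0 (1 - d a y / r)"

lemma bump_self: "a \<in> M \<Longrightarrow> bump a r a = 1"
  by (simp add: bump_def)

lemma bump_nonneg: "bump a r y \<ge> 0"
  by (simp add: bump_def)

lemma continuous_map_bump: "a \<in> M \<Longrightarrow> continuous_map mtopology euclideanreal (bump a r)"
  unfolding bump_def divide_inverse
  by (intro continuous_map_real_max continuous_map_diff continuous_map_real_mult continuous_map_dist) simp_all

lemma bump_neq_0_iff: "r > 0 \<Longrightarrow> bump a r y \<noteq> 0 \<longleftrightarrow> d a y < r"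
  by (auto simp: bump_def max_def field_simps)

text \<open>A ball of radius \<open>\<epsilon> / 4\<close> around \<open>x\<close> meets at most one
  support: two such centres would both be within \<open>\<epsilon> / 2\<close> of \<open>x\<close>,
  hence closer than \<open>\<epsilon>\<close> to each other.\<close>

lemma locally_finite_bump_separated:
  assumes D: "D \<subseteq> M" "\<And>x y. x \<in> D \<Longrightarrow> y \<in> D \<Longrightarrow> x \<noteq> y \<Longrightarrow> d x y \<ge> \<epsilon>" and \<epsilon>: "\<epsilon> > 0"
  shows "locally_finite_functions mtopology D (\<lambda>a. bump a (\<epsilon> / 4))"
  unfolding locally_finite_functions_def
proof (intro conjI ballI)
  show "continuous_map mtopology euclideanreal (bump a (\<epsilon> / 4))" if "a \<in> D" for a
    using continuous_map_bump that D(1) by blast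
  fix x assume "x \<in> topspace mtopology"
  then have x: "x \<in> M" by simp
  let ?S = "{a \<in> D. \<exists>y\<in>mball x (\<epsilon> / 4). bump a (\<epsilon> / 4) y \<noteq> 0}"
  have close: "a \<in> D \<and> d a x < \<epsilon> / 2" if a: "a \<in> ?S" for a
  proof -
    obtain y where y: "a \<in> D" "y \<in> mball x (\<epsilon> / 4)" "bump a (\<epsilon> / 4) y \<noteq> 0"
      using a by auto
    then have "d a y < \<epsilon> / 4" using bump_neq_0_iff[of "\<epsilon> / 4" a y] \<epsilon> by simp
    moreover have "d a x \<le> d a y + d x y"
      using triangle'[of a y x] D(1) y x by auto
    ultimately show ?thesis using y by auto
  qed
  have eq: "a = b" if "a \<in> ?S" "b \<in> ?S" for a b
  proof (rule ccontr)
    assume "a \<noteq> b"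
    then have "\<epsilon> \<le> d a b" using close[OF that(1)] close[OF that(2)] D(2) by simp
    moreover have "d a b \<le> d a x + d b x"
      using triangle'[of a x b] D(1) close[OF that(1)] close[OF that(2)] x by auto
    ultimately show False using close[OF that(1)] close[OF that(2)] by simp
  qed
  have "finite ?S"
  proof (cases "?S = {}")
    case False
    then obtain a where "a \<in> ?S" by blast
    with eq have "?S \<subseteq> {a}" by blast
    then show ?thesis by (rule finite_subset) simp
  qed (simp only: finite.emptyI)
  then show "\<exists>U. openin mtopology U \<and> x \<in> U \<and> finite {a \<in> D. \<exists>y\<in>U. bump a (\<epsilon> / 4) y \<noteq> 0}"
    using x \<epsilon> by (intro exI[of _ "mball x (\<epsilon> / 4)"]) (simp only: openin_mball centre_in_mball_iff, simp)
qed

lemma isolated_from_derived_set: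
  assumes "x \<in> M" "x \<notin> mtopology derived_set_of T"
  obtains s where "s > 0" "\<And>t. t \<in> T \<Longrightarrow> t \<in> M \<Longrightarrow> d x t < s \<Longrightarrow> t = x"
proof -
  obtain U where U: "x \<in> U" "openin mtopology U" "\<not> (\<exists>y. y \<noteq> x \<and> y \<in> T \<and> y \<in> U)"
    using assms unfolding derived_set_of_def by auto
  then obtain s where "s > 0" "mball x s \<subseteq> U"
    unfolding openin_mtopology by blast
  with U assms(1) show ?thesis by (intro that[of s]) auto
qed

text \<open>The supports shrink and the centres do not accumulate. A support that meets a small ball
  around \<open>x\<close> has either a small index or a centre so near to \<open>x\<close> that it
  equals \<open>x\<close>, which by injectivity happens for at most one index.\<close>

lemma locally_finite_bump_sequence:
  fixes a :: "nat \<Rightarrow> 'a"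
  assumes a: "inj a" "range a \<subseteq> M" "mtopology derived_set_of (range a) = {}"
    and r: "\<And>i. r i > 0" "\<And>i. r i \<le> 1 / (real i + 1)"
  shows "locally_finite_functions mtopology UNIV (\<lambda>i. bump (a i) (r i))"
  unfolding locally_finite_functions_def
proof (intro conjI ballI)
  show "continuous_map mtopology euclideanreal (bump (a i) (r i))" for i
    by (rule continuous_map_bump) (use a in auto)
  fix x assume "x \<in> topspace mtopology"
  then have x: "x \<in> M" by simp
  obtain s where s: "s > 0" "\<And>t. t \<in> range a \<Longrightarrow> t \<in> M \<Longrightarrow> d x t < s \<Longrightarrow> t = x"
    using isolated_from_derived_set[of x "range a"] x a(3) by auto
  let ?S = "{i \<in> UNIV. \<exists>y\<in>mball x (s / 2). bump (a i) (r i) y \<noteq> 0}"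
  have sub: "?S \<subseteq> {..nat \<lceil>2 / s\<rceil>} \<union> a -` {x}"
  proof
    fix i assume "i \<in> ?S"
    then obtain y where y: "y \<in> mball x (s / 2)" "bump (a i) (r i) y \<noteq> 0" by auto
    then have 1: "d (a i) y < 1 / (real i + 1)"
      using bump_neq_0_iff[of "r i" "a i" y] r[of i] by linarith
    show "i \<in> {..nat \<lceil>2 / s\<rceil>} \<union> a -` {x}"
    proof (cases "1 / (real i + 1) \<le> s / 2")
      case True
      have "d x (a i) \<le> d x y + d (a i) y"
        using triangle'[of x y "a i"] y x a(2) by auto
      then have "d x (a i) < s" using 1 y True by auto
      then have "a i = x" using s(2)[of "a i"] a(2) by auto
      then show ?thesis by simp
    next
      case False
      then have "real i < 2 / s" using s(1) by (simp add: field_simps)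
      then have "i \<le> nat \<lceil>2 / s\<rceil>" by linarith
      then show ?thesis by simp
    qed
  qed
  have "finite ({..nat \<lceil>2 / s\<rceil>} \<union> a -` {x})"
    using finite_vimageI[OF _ a(1), of "{x}"] by simp
  then have "finite ?S" by (rule finite_subset[OF sub])
  then show "\<exists>U. openin mtopology U \<and> x \<in> U \<and> finite {i \<in> UNIV. \<exists>y\<in>U. bump (a i) (r i) y \<noteq> 0}"
    using x s(1) by (intro exI[of _ "mball x (s / 2)"]) (simp only: openin_mball centre_in_mball_iff, simp)
qed

text \<open>Failure of the Bolzano-Weierstrass property gives an infinite subset of the ball without
  accumulation points; a sequence in it carries narrow bumps.\<close>

lemma noncompact_mcball_functions:
  assumes p: "p \<in> M" and nc: "\<not> compactin mtopology (mcball p r)"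
  obtains a :: "nat \<Rightarrow> 'a" and \<phi> \<rho> where "\<rho> > 0" "\<And>i. a i \<in> mcball p r"
    "locally_finite_functions mtopology UNIV \<phi>" "\<And>i. \<phi> i (a i) = 1" "\<And>i y. \<phi> i y \<ge> 0"
    "\<And>i y. y \<in> mball p \<rho> \<Longrightarrow> \<phi> i y = 0"
proof -
  obtain T where T: "T \<subseteq> mcball p r" "infinite T" "mcball p r \<inter> mtopology derived_set_of T = {}"
    using nc mcball_subset_mspace unfolding compactin_eq_Bolzano_Weierstrass by blast
  \<comment> \<open>The ball is closed, so it would contain every accumulation point of
    \<open>T\<close>; hence there are none in the whole space.\<close>
  have "mtopology derived_set_of T \<subseteq> mtopology derived_set_of (mcball p r)"
    by (rule derived_set_of_mono[OF T(1)])
  also have "\<dots> \<subseteq> mcball p r"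
    using closedin_mcball[of p r] by (simp add: closedin_contains_derived_set)
  finally have T0: "mtopology derived_set_of T = {}" using T(3) by blast
  obtain s where s: "s > 0" "\<And>t. t \<in> T \<Longrightarrow> t \<in> M \<Longrightarrow> d p t < s \<Longrightarrow> t = p"
    using isolated_from_derived_set[of p T] p T0 by auto
  have "infinite (T - {p})" using T(2) by simp
  then obtain a :: "nat \<Rightarrow> 'a" where a: "inj a" "range a \<subseteq> T - {p}"
    using infinite_countable_subset by blast
  have "mtopology derived_set_of (range a) \<subseteq> mtopology derived_set_of T"
    by (rule derived_set_of_mono) (use a in blast)
  then have a0: "mtopology derived_set_of (range a) = {}" using T0 by simp
  have aT: "a i \<in> T" "a i \<noteq> p" "a i \<in> M" for i
    using a(2) T(1) by (auto simp: image_subset_iff)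
  \<comment> \<open>The first bound makes the family locally finite, the second keeps the supports
    away from \<open>p\<close>, which has distance at least \<open>s\<close> from every
    \<open>a i\<close>.\<close>
  define R where "R i = min (1 / (real i + 1)) (s / 2)" for i
  have R: "R i > 0" "R i \<le> 1 / (real i + 1)" "R i \<le> s / 2" for i
    using s(1) by (auto simp: R_def)
  show ?thesis
  proof (rule that[of "s / 2" a "\<lambda>i. bump (a i) (R i)"])
    show "locally_finite_functions mtopology UNIV (\<lambda>i. bump (a i) (R i))"
      by (rule locally_finite_bump_sequence[OF a(1) _ a0 R(1,2)]) (use aT in auto)
    show "bump (a i) (R i) y = 0" if y: "y \<in> mball p (s / 2)" for i y
    proof (rule ccontr)
      assume "bump (a i) (R i) y \<noteq> 0"
      then have "d (a i) y < s / 2" using bump_neq_0_iff[of "R i" "a i" y] R[of i] by linarith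
      moreover have "d p (a i) \<le> d p y + d (a i) y"
        using triangle'[of p y "a i"] y p aT(3)[of i] by auto
      ultimately have "d p (a i) < s" using y by auto
      then show False using s(2)[of "a i"] aT[of i] by simp
    qed
    show "a i \<in> mcball p r" for i using aT T(1) by blast
  qed (use s(1) aT in \<open>simp_all add: bump_self bump_nonneg\<close>)
qed

lemma nonisolated_sequence:
  assumes p: "p \<in> M" "\<not> openin mtopology {p}" and \<delta>: "\<delta> > 0"
  obtains x :: "nat \<Rightarrow> 'a" where "\<And>n. x n \<in> mball p \<delta>" "\<And>n. x n \<noteq> p"
    "\<And>U. openin mtopology U \<Longrightarrow> p \<in> U \<Longrightarrow> \<exists>N. \<forall>n\<ge>N. x n \<in> U"
proof -
  have "\<exists>y. y \<in> mball p (\<delta> / (real n + 1)) \<and> y \<noteq> p" for n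
  proof (rule ccontr)
    assume "\<not> ?thesis"
    moreover have "p \<in> mball p (\<delta> / (real n + 1))" using p \<delta> by simp
    ultimately have "mball p (\<delta> / (real n + 1)) = {p}" by blast
    then show False using openin_mball[of p "\<delta> / (real n + 1)"] p(2) by simp
  qed
  then obtain x where x: "\<And>n. x n \<in> mball p (\<delta> / (real n + 1))" "\<And>n. x n \<noteq> p" by metis
  have le: "\<delta> / (real n + 1) \<le> \<delta> / (real N + 1)" if "N \<le> n" for n N
    using that \<delta> by (intro divide_left_mono) auto
  show ?thesis
  proof (rule that[of x])
    show "x n \<in> mball p \<delta>" for n
      using x(1)[of n] le[of 0 n] by auto
    fix U assume "openin mtopology U" "p \<in> U"
    then obtain r where r: "r > 0" "mball p r \<subseteq> U" unfolding openin_mtopology by blast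
    obtain N :: nat where N: "\<delta> / r < real N" using reals_Archimedean2 by blast
    then have "\<delta> / (real N + 1) < r" using r(1) by (simp add: field_simps)
    then have "x n \<in> U" if "n \<ge> N" for n
      using x(1)[of n] le[OF that] r(2) by auto
    then show "\<exists>N. \<forall>n\<ge>N. x n \<in> U" by blast
  qed (rule x(2))
qed

text \<open>Zorn's lemma gives maximal \<open>\<epsilon>\<close>-separated sets, and maximality
  makes them \<open>\<epsilon>\<close>-dense. If those for \<open>\<epsilon> = 1 / (n + 1)\<close>
  were all countable, their union would be a countable dense set.\<close>

lemma not_separable_separated:
  assumes "\<not> separable_space mtopology"
  obtains \<epsilon> D where "\<epsilon> > 0" "D \<subseteq> M" "uncountable D"
    "\<And>x y. x \<in> D \<Longrightarrow> y \<in> D \<Longrightarrow> x \<noteq> y \<Longrightarrow> d x y \<ge> \<epsilon>"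
proof -
  define \<A> where "\<A> \<epsilon> = {S. S \<subseteq> M \<and> (\<forall>x\<in>S. \<forall>y\<in>S. x \<noteq> y \<longrightarrow> d x y \<ge> \<epsilon>)}" for \<epsilon>
  have "\<exists>S\<in>\<A> \<epsilon>. \<forall>T\<in>\<A> \<epsilon>. S \<subseteq> T \<longrightarrow> T = S" for \<epsilon>
  proof (rule subset_Zorn_nonempty)
    show "\<A> \<epsilon> \<noteq> {}" by (auto simp: \<A>_def)
    fix C assume C: "C \<noteq> {}" "subset.chain (\<A> \<epsilon>) C"
    have "d x y \<ge> \<epsilon>" if "A \<in> C" "B \<in> C" "x \<in> A" "y \<in> B" "x \<noteq> y" for x y A B
    proof -
      have "A \<subseteq> B \<or> B \<subseteq> A" using C(2) that(1,2) by (auto simp: subset.chain_def)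
      moreover have "A \<in> \<A> \<epsilon>" "B \<in> \<A> \<epsilon>" using C(2) that(1,2) by (auto simp: subset.chain_def)
      ultimately show ?thesis using that(3-5) by (auto simp: \<A>_def)
    qed
    moreover have "\<Union>C \<subseteq> M" using C(2) by (auto simp: subset.chain_def \<A>_def)
    ultimately show "\<Union>C \<in> \<A> \<epsilon>" by (auto simp: \<A>_def)
  qed
  then obtain S where S: "\<And>\<epsilon>. S \<epsilon> \<in> \<A> \<epsilon>" "\<And>\<epsilon> T. T \<in> \<A> \<epsilon> \<Longrightarrow> S \<epsilon> \<subseteq> T \<Longrightarrow> T = S \<epsilon>" by metis
  have near: "\<exists>y\<in>S \<epsilon>. d x y < \<epsilon>" if x: "x \<in> M" and \<epsilon>: "\<epsilon> > 0" for x \<epsilon>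
  proof (rule ccontr)
    assume n: "\<not> ?thesis"
    then have "insert x (S \<epsilon>) \<in> \<A> \<epsilon>"
      using S(1)[of \<epsilon>] x by (auto simp: \<A>_def not_less commute)
    then have "x \<in> S \<epsilon>" using S(2)[of "insert x (S \<epsilon>)" \<epsilon>] by blast
    then show False using n x \<epsilon> by auto
  qed
  have "\<exists>n. uncountable (S (1 / (real n + 1)))"
  proof (rule ccontr)
    assume "\<not> ?thesis"
    then have "countable (\<Union>n. S (1 / (real n + 1)))" by auto
    moreover have SM: "(\<Union>n. S (1 / (real n + 1))) \<subseteq> M" using S(1) by (auto simp: \<A>_def)
    moreover have "mtopology closure_of (\<Union>n. S (1 / (real n + 1))) = M"
    proof -
      have "\<exists>y\<in>(\<Union>n. S (1 / (real n + 1))). y \<in> mball x r" if x: "x \<in> M" and r: "r > 0" for x r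
      proof -
        obtain n :: nat where n: "1 / r < real n" using reals_Archimedean2 by blast
        then have nr: "1 / (real n + 1) < r" using r by (simp add: field_simps)
        obtain y where y: "y \<in> S (1 / (real n + 1))" "d x y < 1 / (real n + 1)"
          using near[OF x, of "1 / (real n + 1)"] by auto
        then have "y \<in> mball x r" using nr SM x by auto
        with y show ?thesis by blast
      qed
      then show ?thesis unfolding metric_closure_of by auto
    qed
    ultimately show False using assms unfolding separable_space_def by (metis topspace_mtopology)
  qed
  then obtain n where n: "uncountable (S (1 / (real n + 1)))" by blast
  show ?thesis
    by (rule that[OF _ _ n]) (use S(1)[of "1 / (real n + 1)"] in \<open>auto simp: \<A>_def\<close>)
qed

end

section \<open>Necessity of the condition on the space\<close>

text \<open>The set \<open>Z\<close> is left open so that one argument serves both the whole group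
  and the words of length at most 8. A locally compact counterexample is nonseparable and has a
  nonisolated point; any other one has a point without compact neighbourhood.\<close>

theorem compactly_continuous_imp_locally_compact_separable_or_discrete:
  fixes X :: "'a topology" and Z :: "'a word set"
  defines "T \<equiv> subtopology (free_topology X) Z"
  assumes X: "metrizable_space X"
    and kR: "\<And>f :: 'a word \<Rightarrow> real.
        (\<And>K. compactin T K \<Longrightarrow> continuous_map (subtopology T K) euclideanreal f) \<Longrightarrow>
        continuous_map T euclideanreal f"
    and Z: "\<And>w. w \<in> carrier (free_group (topspace X)) \<Longrightarrow> length w \<le> 8 \<Longrightarrow> w \<in> Z"
  shows "(locally_compact_space X \<and> separable_space X) \<or> X = discrete_topology (topspace X)"
proof (rule ccontr)
  assume neg: "\<not> ?thesis"
  obtain M d where "Metric_space M d" and XM: "X = Metric_space.mtopology M d"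
    using X unfolding metrizable_space_def by blast
  interpret Metric_space M d by fact
  have topX: "topspace X = M" by (simp add: XM)
  have \<psi>: "continuous_map X euclideanreal (d p)" "d p p = 0" if "p \<in> M" for p
    using continuous_map_dist[OF that] that by (simp_all add: XM)
  show False
  proof (cases "locally_compact_space X")
    case True
    with neg have ns: "\<not> separable_space mtopology" and "X \<noteq> discrete_topology (topspace X)"
      by (auto simp: XM)
    then obtain p where p: "p \<in> M" "\<not> openin mtopology {p}"
      using discrete_topology_unique[of M X] by (auto simp: XM)
    obtain \<epsilon> D where D: "\<epsilon> > 0" "D \<subseteq> M" "uncountable D"
        "\<And>x y. x \<in> D \<Longrightarrow> y \<in> D \<Longrightarrow> x \<noteq> y \<Longrightarrow> d x y \<ge> \<epsilon>"
      using not_separable_separated[OF ns] by metis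
    \<comment> \<open>Points of \<open>D\<close> close to \<open>p\<close> are discarded so that the
      remaining bumps vanish on a ball around \<open>p\<close>; by separation at most one point is
      lost.\<close>
    define E where "E = {a \<in> D. d p a \<ge> \<epsilon> / 2}"
    have eq: "a = b" if "a \<in> D - E" "b \<in> D - E" for a b
    proof (rule ccontr)
      assume "a \<noteq> b"
      then have "\<epsilon> \<le> d a b" using that D(4) by simp
      moreover have "d a b \<le> d p a + d p b"
        using triangle''[of a p b] triangle'[of a p b] that D(2) p by (auto simp: commute)
      ultimately show False using that by (auto simp: E_def)
    qed
    have "countable (D - E)"
    proof (cases "D - E = {}")
      case False
      then obtain a where "a \<in> D - E" by blast
      with eq have "D - E \<subseteq> {a}" by blast
      then show ?thesis by (rule countable_subset) simp
    qed (simp only: countable_empty)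
    then have E: "uncountable E"
      using D(3) countable_Un[of "D - E" E] by (auto simp: E_def Un_absorb1 elim: countable_subset[rotated])
    have ED: "E \<subseteq> D" by (auto simp: E_def)
    have \<epsilon>4: "\<epsilon> / 4 > 0" using D(1) by simp
    obtain x :: "nat \<Rightarrow> 'a" where x: "\<And>n. x n \<in> mball p (\<epsilon> / 4)" "\<And>n. x n \<noteq> p"
        "\<And>U. openin mtopology U \<Longrightarrow> p \<in> U \<Longrightarrow> \<exists>N. \<forall>n\<ge>N. x n \<in> U"
      using nonisolated_sequence[OF p \<epsilon>4] by metis
    have zero: "bump a (\<epsilon> / 4) y = 0" if a: "a \<in> E" and y: "y \<in> mball p (\<epsilon> / 4)" for a y
    proof (rule ccontr)
      assume "bump a (\<epsilon> / 4) y \<noteq> 0"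
      then have "d a y < \<epsilon> / 4" using bump_neq_0_iff[OF \<epsilon>4] by simp
      moreover have "d p a \<le> d p y + d a y"
        using triangle'[of p y a] y p a ED D(2) by auto
      ultimately show False using a y by (auto simp: E_def)
    qed
    show False
    proof (rule not_kR_uncountable_family[where X = X and Z = Z and p = p and x = x and \<psi> = "d p"
          and D = E and \<eta> = "\<lambda>a. bump a (\<epsilon> / 4)"])
      show "locally_finite_functions X E (\<lambda>a. bump a (\<epsilon> / 4))"
        unfolding XM by (rule locally_finite_bump_separated[OF _ D(4) D(1)]) (use ED D(2) in auto)
      show "bump a (\<epsilon> / 4) a = 1" if "a \<in> E" for a using that ED D(2) by (intro bump_self) blast
      show "d p (x n) > 0" for n using x(1)[of n] x(2)[of n] p by (auto simp: mdist_pos_eq)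
      show "bump a (\<epsilon> / 4) p = 0" if "a \<in> E" for a using zero[OF that, of p] p \<epsilon>4 by simp
      show "bump a (\<epsilon> / 4) (x n) = 0" if "a \<in> E" for a n by (rule zero[OF that x(1)])
      show "\<exists>N. \<forall>n\<ge>N. x n \<in> U" if "openin X U" "p \<in> U" for U using x(3) that by (simp add: XM)
      show "x n \<in> topspace X" for n using x(1)[of n] by (auto simp: topX)
      show "E \<subseteq> topspace X" using ED D(2) by (auto simp: topX)
    qed (use kR Z E \<psi> p in \<open>simp_all add: T_def topX bump_nonneg\<close>)
  next
    case False
    then obtain p where p: "p \<in> M" "\<And>U K. openin X U \<Longrightarrow> compactin X K \<Longrightarrow> p \<in> U \<Longrightarrow> \<not> U \<subseteq> K"
      unfolding locally_compact_space_def topX by blast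
    have nc: "\<not> compactin mtopology (mcball p r)" if "r > 0" for r
      using p(2)[of "mball p r" "mcball p r"] p(1) that by (auto simp: XM mball_subset_mcball)
    have np: "\<not> openin mtopology {p}"
      using p(2)[of "{p}" "{p}"] p(1) by (auto simp: XM)
    obtain b :: "nat \<Rightarrow> 'a" and \<phi> \<rho> where \<phi>: "\<rho> > 0" "\<And>i. b i \<in> mcball p 1"
        "locally_finite_functions mtopology UNIV \<phi>" "\<And>i. \<phi> i (b i) = 1" "\<And>i y. \<phi> i y \<ge> 0"
        "\<And>i y. y \<in> mball p \<rho> \<Longrightarrow> \<phi> i y = 0"
      using noncompact_mcball_functions[OF p(1) nc[OF zero_less_one]] by metis
    obtain x :: "nat \<Rightarrow> 'a" where x: "\<And>n. x n \<in> mball p \<rho>" "\<And>n. x n \<noteq> p"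
        "\<And>U. openin mtopology U \<Longrightarrow> p \<in> U \<Longrightarrow> \<exists>N. \<forall>n\<ge>N. x n \<in> U"
      using nonisolated_sequence[OF p(1) np \<phi>(1)] by metis
    have "\<exists>(a :: nat \<Rightarrow> 'a) \<eta>. (\<forall>i. a i \<in> mcball p (1 / (real n + 1))) \<and>
        locally_finite_functions mtopology UNIV \<eta> \<and> (\<forall>i. \<eta> i (a i) = 1) \<and> (\<forall>i y. \<eta> i y \<ge> 0) \<and>
        (\<forall>i. \<eta> i p = 0)" for n
    proof -
      have n: "1 / (real n + 1) > 0" by simp
      obtain a :: "nat \<Rightarrow> 'a" and \<eta> \<sigma> where "\<sigma> > 0" "\<And>i. a i \<in> mcball p (1 / (real n + 1))"
        "locally_finite_functions mtopology UNIV \<eta>" "\<And>i. \<eta> i (a i) = 1" "\<And>i y. \<eta> i y \<ge> 0"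
        "\<And>i y. y \<in> mball p \<sigma> \<Longrightarrow> \<eta> i y = 0"
        using noncompact_mcball_functions[OF p(1) nc[OF n]] by metis
      then show ?thesis using p(1) by (intro exI[of _ a] exI[of _ \<eta>]) auto
    qed
    then obtain a :: "nat \<Rightarrow> nat \<Rightarrow> 'a" and \<eta> where \<eta>: "\<And>n i. a n i \<in> mcball p (1 / (real n + 1))"
        "\<And>n. locally_finite_functions mtopology UNIV (\<eta> n)" "\<And>n i. \<eta> n i (a n i) = 1"
        "\<And>n i y. \<eta> n i y \<ge> 0" "\<And>n i. \<eta> n i p = 0"
      by metis
    show False
    proof (rule not_kR_countable_family[where X = X and Z = Z and p = p and x = x and \<psi> = "d p"
          and d = b and \<phi> = \<phi> and a = a and \<eta> = \<eta>])
      show "d p (x n) > 0" for n using x(1)[of n] x(2)[of n] p(1) by (auto simp: mdist_pos_eq)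
      show "\<phi> n p = 0" for n using \<phi>(1) p(1) by (intro \<phi>(6)) simp
      show "\<phi> n (x i) = 0" for n i by (rule \<phi>(6)[OF x(1)])
      show "\<exists>N. \<forall>n\<ge>N. x n \<in> U" if "openin X U" "p \<in> U" for U using x(3) that by (simp add: XM)
      show "x n \<in> topspace X" "b n \<in> topspace X" "a n i \<in> topspace X" for n i
        using x(1)[of n] \<phi>(2)[of n] \<eta>(1)[of n i] by (auto simp: topX)
      fix U assume "openin X U" "p \<in> U"
      then obtain r where r: "r > 0" "mball p r \<subseteq> U" unfolding XM openin_mtopology by blast
      obtain n :: nat where "1 / r < real n" using reals_Archimedean2 by blast
      then have "1 / (real n + 1) < r" using r(1) by (simp add: field_simps)
      then have "a n i \<in> U" for i using \<eta>(1)[of n i] r(2) by auto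
      then show "\<exists>n. \<forall>i. a n i \<in> U" by blast
    qed (use kR Z \<psi> p(1) \<phi> \<eta> in \<open>simp_all add: T_def topX XM\<close>)
  qed
qed

section \<open>Separation of words in \<open>SL\<^sub>2\<close>\<close>

definition mat2_mult :: "real \<times> real \<times> real \<times> real \<Rightarrow> real \<times> real \<times> real \<times> real \<Rightarrow> real \<times> real \<times> real \<times> real" where
  "mat2_mult = (\<lambda>(a, b, c, d) (a', b', c', d').
     (a * a' + b * c', a * b' + b * d', c * a' + d * c', c * b' + d * d'))"

lemma mat2_mult_simp [simp]:
  "mat2_mult (a, b, c, d) (a', b', c', d') =
     (a * a' + b * c', a * b' + b * d', c * a' + d * c', c * b' + d * d')"
  by (simp add: mat2_mult_def)

lemma continuous_on_mat2_mult:
  "continuous_on S f \<Longrightarrow> continuous_on S g \<Longrightarrow> continuous_on S (\<lambda>x. mat2_mult (f x) (g x))"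
  unfolding mat2_mult_def case_prod_unfold by (intro continuous_intros)

definition SL2 :: "(real \<times> real \<times> real \<times> real) monoid" where
  "SL2 = \<lparr>carrier = {(a, b, c, d). a * d - b * c = 1}, mult = mat2_mult, one = (1, 0, 0, 1)\<rparr>"

lemma SL2_simps [simp]:
  "(a, b, c, d) \<in> carrier SL2 \<longleftrightarrow> a * d - b * c = 1" "\<one>\<^bsub>SL2\<^esub> = (1, 0, 0, 1)"
  "x \<otimes>\<^bsub>SL2\<^esub> y = mat2_mult x y"
  by (simp_all add: SL2_def)

lemma group_SL2: "group SL2"
proof (rule groupI)
  fix x y assume "x \<in> carrier SL2" "y \<in> carrier SL2"
  moreover obtain a b c d a' b' c' d' where "x = (a, b, c, d)" "y = (a', b', c', d')"
    by (cases x; cases y) auto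
  moreover have "(a * a' + b * c') * (c * b' + d * d') - (a * b' + b * d') * (c * a' + d * c') =
      (a * d - b * c) * (a' * d' - b' * c')"
    by (simp add: algebra_simps)
  ultimately show "x \<otimes>\<^bsub>SL2\<^esub> y \<in> carrier SL2" by simp
next
  fix x assume x: "x \<in> carrier SL2"
  obtain a b c d where "x = (a, b, c, d)" by (cases x) auto
  with x show "\<exists>y\<in>carrier SL2. y \<otimes>\<^bsub>SL2\<^esub> x = \<one>\<^bsub>SL2\<^esub>"
    by (intro bexI[of _ "(d, - b, - c, a)"]) (auto simp: algebra_simps)
qed (auto simp: algebra_simps)

lemma inv_SL2: "(a, b, c, d) \<in> carrier SL2 \<Longrightarrow> inv\<^bsub>SL2\<^esub> (a, b, c, d) = (d, - b, - c, a)"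
  by (rule group.inv_equality[OF group_SL2]) (auto simp: algebra_simps)

lemma topological_group_SL2: "topological_group SL2 (top_of_set (carrier SL2))"
proof -
  interpret group SL2 by (rule group_SL2)
  let ?C = "carrier SL2"
  have "continuous_on (?C \<times> ?C) (\<lambda>(x, y). mat2_mult x y)"
    unfolding mat2_mult_def case_prod_unfold by (intro continuous_intros)
  moreover have "(\<lambda>(x, y). mat2_mult x y) ` (?C \<times> ?C) \<subseteq> ?C"
    using m_closed by auto
  ultimately have 1: "continuous_map (top_of_set (?C \<times> ?C)) (top_of_set ?C) (\<lambda>(x, y). mat2_mult x y)"
    by (simp add: continuous_map_subtopology_eu image_subset_iff_funcset)
  have "continuous_on ?C (\<lambda>x. (snd (snd (snd x)), - fst (snd x), - fst (snd (snd x)), fst x))"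
    by (intro continuous_intros)
  then have "continuous_on ?C (\<lambda>x. inv\<^bsub>SL2\<^esub> x)"
    by (rule continuous_on_eq) (metis inv_SL2 prod.collapse)
  moreover have "(\<lambda>x. inv\<^bsub>SL2\<^esub> x) ` ?C \<subseteq> ?C" by auto
  ultimately have 2: "continuous_map (top_of_set ?C) (top_of_set ?C) (\<lambda>x. inv\<^bsub>SL2\<^esub> x)"
    by (simp add: continuous_map_subtopology_eu image_subset_iff_funcset)
  show ?thesis
    using 1 2 group_SL2 by (simp add: topological_group_def)
qed

text \<open>\<open>hyperbolic \<mu> t\<close> stretches the direction \<open>(1, t)\<close> by \<open>1 / \<mu>\<close> and the orthogonal direction
  \<open>(- t, 1)\<close> by \<open>\<mu>\<close>; its inverse exchanges the two. \<open>scaled_letter\<close> is \<open>\<mu>\<close> times the matrix of a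
  letter, and for \<open>\<mu> = 0\<close> it is an orthogonal projection onto a line. In a reduced word with distinct
  nonnegative parameters \<open>t\<close> for distinct points, consecutive lines are never orthogonal, so the product
  of these projections is nonzero, which rules out that the word is trivial for all \<open>\<mu>\<close>.\<close>

definition hyperbolic :: "real \<Rightarrow> real \<Rightarrow> real \<times> real \<times> real \<times> real" where
  "hyperbolic \<mu> t = (1 / (1 + t\<^sup>2) * (1 / \<mu> + \<mu> * t\<^sup>2), 1 / (1 + t\<^sup>2) * ((1 / \<mu> - \<mu>) * t),
     1 / (1 + t\<^sup>2) * ((1 / \<mu> - \<mu>) * t), 1 / (1 + t\<^sup>2) * (t\<^sup>2 / \<mu> + \<mu>))"

definition scaled_letter :: "real \<Rightarrow> bool \<Rightarrow> real \<Rightarrow> real \<times> real \<times> real \<times> real" where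
  "scaled_letter \<mu> b t =
     (if b then (1 / (1 + t\<^sup>2) * (1 + \<mu>\<^sup>2 * t\<^sup>2), 1 / (1 + t\<^sup>2) * ((1 - \<mu>\<^sup>2) * t),
                 1 / (1 + t\<^sup>2) * ((1 - \<mu>\<^sup>2) * t), 1 / (1 + t\<^sup>2) * (t\<^sup>2 + \<mu>\<^sup>2))
      else (1 / (1 + t\<^sup>2) * (t\<^sup>2 + \<mu>\<^sup>2), 1 / (1 + t\<^sup>2) * ((\<mu>\<^sup>2 - 1) * t),
            1 / (1 + t\<^sup>2) * ((\<mu>\<^sup>2 - 1) * t), 1 / (1 + t\<^sup>2) * (1 + \<mu>\<^sup>2 * t\<^sup>2)))"

definition scaled_word :: "real \<Rightarrow> ('a \<Rightarrow> real) \<Rightarrow> 'a word \<Rightarrow> real \<times> real \<times> real \<times> real" where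
  "scaled_word \<mu> \<theta> w = foldr (\<lambda>a. mat2_mult (scaled_letter \<mu> (fst a) (\<theta> (snd a)))) w (1, 0, 0, 1)"

lemma hyperbolic_in_SL2:
  assumes "\<mu> \<noteq> 0" shows "hyperbolic \<mu> t \<in> carrier SL2"
proof -
  have s: "1 + t\<^sup>2 \<noteq> 0" by (simp add: add_nonneg_eq_0_iff)
  have "(1 / \<mu> + \<mu> * t\<^sup>2) * (t\<^sup>2 / \<mu> + \<mu>) - ((1 / \<mu> - \<mu>) * t) * ((1 / \<mu> - \<mu>) * t) = (1 + t\<^sup>2)\<^sup>2"
    using assms by (simp add: field_simps power2_eq_square)
  then have "(1 / (1 + t\<^sup>2))\<^sup>2 * ((1 / \<mu> + \<mu> * t\<^sup>2) * (t\<^sup>2 / \<mu> + \<mu>) - ((1 / \<mu> - \<mu>) * t) * ((1 / \<mu> - \<mu>) * t)) = 1"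
    using s by (simp add: power_divide)
  then show ?thesis
    unfolding hyperbolic_def SL2_simps by (simp only: power2_eq_square) algebra
qed

lemma continuous_map_hyperbolic:
  assumes "continuous_map X euclideanreal \<theta>" "\<mu> \<noteq> 0"
  shows "continuous_map X (top_of_set (carrier SL2)) (\<lambda>x. hyperbolic \<mu> (\<theta> x))"
proof -
  have "1 + t\<^sup>2 \<noteq> 0" for t :: real by (simp add: add_nonneg_eq_0_iff)
  then have "continuous_on UNIV (hyperbolic \<mu>)"
    unfolding hyperbolic_def using assms(2) by (intro continuous_intros) auto
  then have "continuous_map euclideanreal (top_of_set (carrier SL2)) (hyperbolic \<mu>)"
    using hyperbolic_in_SL2[OF assms(2)]
    by (auto simp: continuous_map_in_subtopology)
  from continuous_map_compose[OF assms(1) this] show ?thesis by (simp add: o_def)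
qed

lemma scaled_letter_eq:
  assumes "\<mu> \<noteq> 0"
  shows "scaled_letter \<mu> b t = \<mu> *\<^sub>R (if b then hyperbolic \<mu> t else inv\<^bsub>SL2\<^esub> (hyperbolic \<mu> t))"
proof -
  define s where "s = 1 / (1 + t\<^sup>2)"
  have "inv\<^bsub>SL2\<^esub> (hyperbolic \<mu> t) =
      (s * (t\<^sup>2 / \<mu> + \<mu>), - (s * ((1 / \<mu> - \<mu>) * t)), - (s * ((1 / \<mu> - \<mu>) * t)), s * (1 / \<mu> + \<mu> * t\<^sup>2))"
    using inv_SL2[OF hyperbolic_in_SL2[OF assms, of t, unfolded hyperbolic_def]]
    by (simp only: hyperbolic_def s_def)
  moreover have "\<mu> * (s * (1 / \<mu> + \<mu> * t\<^sup>2)) = s * (1 + \<mu>\<^sup>2 * t\<^sup>2)"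
    "\<mu> * (s * ((1 / \<mu> - \<mu>) * t)) = s * ((1 - \<mu>\<^sup>2) * t)"
    "\<mu> * (s * (t\<^sup>2 / \<mu> + \<mu>)) = s * (t\<^sup>2 + \<mu>\<^sup>2)"
    using assms by (simp_all add: field_simps power2_eq_square)
  ultimately show ?thesis
    unfolding scaled_letter_def by (simp add: hyperbolic_def s_def[symmetric] algebra_simps)
qed

text \<open>One factor \<open>\<mu>\<close> per letter clears the denominators, so the left side is
  polynomial in \<open>\<mu>\<close> and continuous also at 0.\<close>

lemma scaled_word_eq:
  assumes "\<mu> \<noteq> 0"
  shows "scaled_word \<mu> \<theta> w = \<mu> ^ length w *\<^sub>R word_eval SL2 (\<lambda>x. hyperbolic \<mu> (\<theta> x)) w"
proof (induction w)
  case Nil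
  then show ?case by (simp add: scaled_word_def)
next
  case (Cons a w)
  have lin: "mat2_mult (c *\<^sub>R x) (e *\<^sub>R y) = (c * e) *\<^sub>R mat2_mult x y" for c e x y
    by (cases x; cases y) (simp add: algebra_simps)
  show ?case
    using Cons lin by (simp add: scaled_word_def scaled_letter_eq[OF assms])
qed

lemma continuous_scaled_word: "continuous_on UNIV (\<lambda>\<mu>. scaled_word \<mu> \<theta> w)"
proof (induction w)
  case (Cons a w)
  have "continuous_on UNIV (\<lambda>\<mu>. scaled_letter \<mu> (fst a) t)" for t
  proof -
    have "1 + t\<^sup>2 \<noteq> 0" by (simp add: add_nonneg_eq_0_iff)
    then show ?thesis
      unfolding scaled_letter_def
      by (cases "fst a"; simp only: if_True if_False simp_thms; intro continuous_intros; simp)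
  qed
  from continuous_on_mat2_mult[OF this Cons] show ?case
    by (simp add: scaled_word_def)
qed (simp add: scaled_word_def)

definition direction :: "bool \<Rightarrow> real \<Rightarrow> real \<times> real" where
  "direction b t = (if b then (1, t) else (- t, 1))"

lemma scaled_letter_0:
  "scaled_letter 0 b t =
     (let (p, q) = direction b t; s = 1 / (1 + t\<^sup>2) in (s * (p * p), s * (p * q), s * (q * p), s * (q * q)))"
  by (simp add: scaled_letter_def direction_def Let_def power2_eq_square)

text \<open>A product of rank one projections is the outer product of the first direction with some
  row \<open>(z, z')\<close>. Prepending a letter multiplies the row by \<open>?k\<close>, up to
  scaling the inner product of two adjacent directions, so the row stays nonzero.\<close>

lemma scaled_word_0_nonzero:
  assumes "reduced_word (a # w)" "inj_on \<theta> (snd ` set (a # w))" "\<And>x. \<theta> x \<ge> 0"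
  shows "\<exists>z z'. (z, z') \<noteq> (0, 0) \<and>
     scaled_word 0 \<theta> (a # w) =
       (let (p, q) = direction (fst a) (\<theta> (snd a)) in (p * z, p * z', q * z, q * z'))"
  using assms(1,2)
proof (induction w arbitrary: a)
  case Nil
  obtain p q where pq: "direction (fst a) (\<theta> (snd a)) = (p, q)" by (cases "direction (fst a) (\<theta> (snd a))")
  let ?s = "1 / (1 + (\<theta> (snd a))\<^sup>2)"
  have "1 + (\<theta> (snd a))\<^sup>2 \<noteq> 0" by (simp add: add_nonneg_eq_0_iff)
  moreover have "(p, q) \<noteq> (0, 0)" using pq by (auto simp: direction_def split: if_splits)
  ultimately show ?case
    by (intro exI[of _ "?s * p"] exI[of _ "?s * q"])
       (auto simp: scaled_word_def scaled_letter_0 pq)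
next
  case (Cons b w)
  obtain p q where pq: "direction (fst a) (\<theta> (snd a)) = (p, q)" by (cases "direction (fst a) (\<theta> (snd a))")
  obtain p' q' where pq': "direction (fst b) (\<theta> (snd b)) = (p', q')" by (cases "direction (fst b) (\<theta> (snd b))")
  have "reduced_word (b # w)" "inj_on \<theta> (snd ` set (b # w))"
    using Cons.prems by (auto simp: inj_on_def)
  from Cons.IH[OF this] obtain z z' where z: "(z, z') \<noteq> (0, 0)"
      "scaled_word 0 \<theta> (b # w) = (p' * z, p' * z', q' * z, q' * z')"
    unfolding pq' Let_def case_prod_conv by (elim exE conjE)
  let ?s = "1 / (1 + (\<theta> (snd a))\<^sup>2)"
  let ?k = "?s * (p * p' + q * q')"
  have s: "?s \<noteq> 0" by (simp add: add_nonneg_eq_0_iff)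
  \<comment> \<open>Equal signs give 1 plus the product of two nonnegative parameters. Opposite
    signs give, up to sign, the difference of the parameters, and a reduced word then has different
    points in the two letters.\<close>
  have "p * p' + q * q' \<noteq> 0"
  proof (cases "fst a = fst b")
    case True
    have "\<theta> (snd a) * \<theta> (snd b) \<ge> 0" using assms(3) by simp
    then show ?thesis using True pq pq' by (auto simp: direction_def split: if_splits)
  next
    case False
    then have "snd a \<noteq> snd b"
      using Cons.prems(1) by (auto simp: inv_letter_def prod_eq_iff)
    then have "\<theta> (snd a) \<noteq> \<theta> (snd b)" using Cons.prems(2) by (auto simp: inj_on_def)
    then show ?thesis using False pq pq' by (auto simp: direction_def split: if_splits)
  qed
  with s have k: "?k \<noteq> 0" by simp
  have "scaled_word 0 \<theta> (a # b # w) = mat2_mult (scaled_letter 0 (fst a) (\<theta> (snd a))) (scaled_word 0 \<theta> (b # w))"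
    by (simp add: scaled_word_def)
  also have "\<dots> = (p * (?k * z), p * (?k * z'), q * (?k * z), q * (?k * z'))"
    unfolding z(2) scaled_letter_0 pq by (simp add: algebra_simps add_divide_distrib)
  finally show ?case
    using k z(1) by (intro exI[of _ "?k * z"] exI[of _ "?k * z'"]) (auto simp: pq)
qed

text \<open>If the word were trivial for every nonzero \<open>\<mu>\<close>, its scaled version
  would be \<open>\<mu> ^ length w\<close> times the identity and tend to 0, against the nonzero
  value at \<open>\<mu> = 0\<close>.\<close>

lemma word_eval_SL2_separates:
  assumes "reduced_word w" "w \<noteq> []" "inj_on \<theta> (snd ` set w)" "\<And>x. \<theta> x \<ge> 0"
  obtains \<mu> where "\<mu> \<noteq> 0" "word_eval SL2 (\<lambda>x. hyperbolic \<mu> (\<theta> x)) w \<noteq> \<one>\<^bsub>SL2\<^esub>"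
proof -
  obtain a v where w: "w = a # v" using assms(2) by (cases w) auto
  have "\<exists>\<mu>. \<mu> \<noteq> 0 \<and> word_eval SL2 (\<lambda>x. hyperbolic \<mu> (\<theta> x)) w \<noteq> \<one>\<^bsub>SL2\<^esub>"
  proof (rule ccontr)
    assume "\<not> ?thesis"
    then have one: "word_eval SL2 (\<lambda>x. hyperbolic \<mu> (\<theta> x)) w = (1, 0, 0, 1)" if "\<mu> \<noteq> 0" for \<mu>
      using that by auto
    have eq: "scaled_word \<mu> \<theta> w = \<mu> ^ length w *\<^sub>R (1, 0, 0, 1)" if "\<mu> \<noteq> 0" for \<mu>
      by (simp only: scaled_word_eq[OF that] one[OF that])
    have "((\<lambda>\<mu>. scaled_word \<mu> \<theta> w) \<longlongrightarrow> scaled_word 0 \<theta> w) (at 0)"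
      using continuous_scaled_word[of \<theta> w] by (simp add: continuous_on_def)
    moreover have "((\<lambda>\<mu>. scaled_word \<mu> \<theta> w) \<longlongrightarrow> 0 ^ length w *\<^sub>R (1, 0, 0, 1)) (at 0)"
    proof (rule Lim_transform_eventually)
      show "((\<lambda>\<mu>::real. \<mu> ^ length w *\<^sub>R (1::real, 0::real, 0::real, 1::real)) \<longlongrightarrow> 0 ^ length w *\<^sub>R (1, 0, 0, 1)) (at 0)"
        by (intro tendsto_intros)
      show "\<forall>\<^sub>F \<mu> in at 0. \<mu> ^ length w *\<^sub>R (1, 0, 0, 1) = scaled_word \<mu> \<theta> w"
        using eq by (simp add: eventually_at_filter)
    qed
    ultimately have "scaled_word 0 \<theta> w = 0 ^ length w *\<^sub>R (1, 0, 0, 1)"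
      by (rule tendsto_unique[rotated]) simp
    then have zero: "scaled_word 0 \<theta> (a # v) = (0, 0, 0, 0)" by (simp add: w zero_prod_def)
    obtain z z' p q where "(z, z') \<noteq> (0, 0)" "direction (fst a) (\<theta> (snd a)) = (p, q)"
        "scaled_word 0 \<theta> (a # v) = (p * z, p * z', q * z, q * z')"
      using scaled_word_0_nonzero[OF assms(1,3,4)[unfolded w]]
      by (cases "direction (fst a) (\<theta> (snd a))") auto
    with zero show False by (auto simp: direction_def split: if_splits)
  qed
  then show ?thesis using that by blast
qed

text \<open>The points \<open>u\<close> and \<open>v\<close> are separated by a continuous
  homomorphism to \<open>SL2\<close> that does not kill the quotient \<open>w\<close>. Its
  parameters come from distinct natural numbers at the letters of \<open>w\<close>, extended by
  Tietze from this finite closed set and made nonnegative by absolute values.\<close>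

lemma Hausdorff_space_free_topology:
  assumes "normal_space X" "Hausdorff_space X"
  shows "Hausdorff_space (free_topology X)"
  unfolding Hausdorff_space_def
proof (intro allI impI)
  let ?F = "free_group (topspace X)"
  interpret F: group ?F by (rule group_free_group)
  fix u v assume *: "u \<in> topspace (free_topology X) \<and> v \<in> topspace (free_topology X) \<and> u \<noteq> v"
  then have uv: "u \<in> carrier ?F" "v \<in> carrier ?F" "u \<noteq> v" by (simp_all add: topspace_free_topology)
  define w where "w = inv\<^bsub>?F\<^esub> u \<otimes>\<^bsub>?F\<^esub> v"
  have w: "w \<in> carrier ?F" using uv by (simp add: w_def)
  have "w \<noteq> \<one>\<^bsub>?F\<^esub>"
    using uv F.inv_comm F.inv_equality F.inv_inv F.inv_closed unfolding w_def by metis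
  then have wn: "w \<noteq> []" by (simp add: one_free_group)
  let ?S = "snd ` set w"
  have S: "finite ?S" "?S \<subseteq> topspace X" using w by (auto simp: carrier_free_group)
  have closed: "closedin X ?S"
    using S Hausdorff_imp_t1_space[OF assms(2)] by (simp add: t1_space_closedin_finite)
  have disc: "subtopology X ?S = discrete_topology ?S"
    using S by (intro finite_topspace_imp_discrete_topology) (auto simp: Hausdorff_space_subtopology assms(2))
  obtain f :: "'a \<Rightarrow> nat" and n where "f ` ?S = {i. i < n}" and f: "inj_on f ?S"
    using finite_imp_inj_to_nat_seg[OF S(1)] by metis
  obtain \<theta> where \<theta>: "continuous_map X euclideanreal \<theta>" "\<And>x. x \<in> ?S \<Longrightarrow> \<theta> x = real (f x)"
    by (rule Tietze_extension_realinterval[OF assms(1) closed, of UNIV "\<lambda>x. real (f x)"])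
       (auto simp: disc)
  define \<eta> where "\<eta> = (\<lambda>x. \<bar>\<theta> x\<bar>)"
  have \<eta>: "continuous_map X euclideanreal \<eta>" "inj_on \<eta> ?S" "\<And>x. \<eta> x \<ge> 0"
    using \<theta> f by (auto simp: \<eta>_def inj_on_def intro: continuous_map_real_abs)
  obtain \<mu> where \<mu>: "\<mu> \<noteq> 0" "word_eval SL2 (\<lambda>x. hyperbolic \<mu> (\<eta> x)) w \<noteq> \<one>\<^bsub>SL2\<^esub>"
    using word_eval_SL2_separates[of w \<eta>] w wn \<eta>(2,3) by (auto simp: carrier_free_group)
  let ?h = "word_eval SL2 (\<lambda>x. hyperbolic \<mu> (\<eta> x))"
  have im: "(\<lambda>x. hyperbolic \<mu> (\<eta> x)) ` topspace X \<subseteq> carrier SL2"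
    using hyperbolic_in_SL2[OF \<mu>(1)] by blast
  interpret group_hom ?F SL2 ?h
    by (intro group_hom.intro F.is_group group_SL2 group_hom_axioms.intro word_eval_hom im)
  have ne: "?h u \<noteq> ?h v"
  proof
    assume "?h u = ?h v"
    then have "?h w = \<one>\<^bsub>SL2\<^esub>"
      using uv unfolding w_def by (simp only: hom_mult hom_inv F.inv_closed hom_closed H.l_inv)
    with \<mu>(2) show False by simp
  qed
  have cont: "continuous_map (free_topology X) euclidean ?h"
    using continuous_map_word_eval[OF topological_group_SL2 continuous_map_hyperbolic[OF \<eta>(1) \<mu>(1)]]
    by (simp add: continuous_map_in_subtopology)
  obtain U V where UV: "open U" "open V" "?h u \<in> U" "?h v \<in> V" "U \<inter> V = {}"
    using hausdorff[OF ne] by blast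
  show "\<exists>U V. openin (free_topology X) U \<and> openin (free_topology X) V \<and> u \<in> U \<and> v \<in> V \<and> disjnt U V"
  proof (intro exI conjI)
    show "openin (free_topology X) {z \<in> topspace (free_topology X). ?h z \<in> U}"
      "openin (free_topology X) {z \<in> topspace (free_topology X). ?h z \<in> V}"
      using UV by (auto intro: openin_continuous_map_preimage[OF cont])
    show "disjnt {z \<in> topspace (free_topology X). ?h z \<in> U} {z \<in> topspace (free_topology X). ?h z \<in> V}"
      using UV(5) by (auto simp: disjnt_def)
  qed (use * UV in auto)
qed

section \<open>Weak topologies and topological groups\<close>

definition weak_topology :: "'a topology \<Rightarrow> (nat \<Rightarrow> 'a set) \<Rightarrow> 'a topology" where
  "weak_topology Y C =
     topology (\<lambda>U. U \<subseteq> topspace Y \<and> (\<forall>n. openin (subtopology Y (C n)) (U \<inter> C n)))"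

lemma openin_weak_topology:
  "openin (weak_topology Y C) U \<longleftrightarrow>
     U \<subseteq> topspace Y \<and> (\<forall>n. openin (subtopology Y (C n)) (U \<inter> C n))"
proof -
  have "istopology (\<lambda>U. U \<subseteq> topspace Y \<and> (\<forall>n. openin (subtopology Y (C n)) (U \<inter> C n)))"
    unfolding istopology_def
  proof (intro conjI allI impI)
    fix S T n
    assume "S \<subseteq> topspace Y \<and> (\<forall>n. openin (subtopology Y (C n)) (S \<inter> C n))"
      and "T \<subseteq> topspace Y \<and> (\<forall>n. openin (subtopology Y (C n)) (T \<inter> C n))"
    then have "openin (subtopology Y (C n)) ((S \<inter> C n) \<inter> (T \<inter> C n))"
      by (simp add: openin_Int)
    then show "openin (subtopology Y (C n)) (S \<inter> T \<inter> C n)"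
      by (simp add: Int_ac)
  next
    fix \<K> n
    assume "\<forall>K\<in>\<K>. K \<subseteq> topspace Y \<and> (\<forall>n. openin (subtopology Y (C n)) (K \<inter> C n))"
    then have "openin (subtopology Y (C n)) (\<Union>K\<in>\<K>. K \<inter> C n)"
      by (intro openin_Union) auto
    then show "openin (subtopology Y (C n)) (\<Union>\<K> \<inter> C n)" by (simp only: Int_Union2)
  qed auto
  then show ?thesis by (simp add: weak_topology_def)
qed

lemma topspace_weak_topology [simp]: "topspace (weak_topology Y C) = topspace Y"
proof
  show "topspace (weak_topology Y C) \<subseteq> topspace Y"
    using openin_topspace[of "weak_topology Y C"] by (simp only: openin_weak_topology)
  have "openin (weak_topology Y C) (topspace Y)"
    by (simp add: openin_weak_topology openin_subtopology_Int)
  then show "topspace Y \<subseteq> topspace (weak_topology Y C)" by (rule openin_subset)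
qed

text \<open>A compact Hausdorff space is normal, so a neighbourhood of \<open>A\<close> in
  \<open>C\<close> can be shrunk to one whose closure, taken in \<open>C\<close>, still lies in
  \<open>U\<close>.\<close>

lemma compact_Hausdorff_neighbourhood:
  assumes Y: "Hausdorff_space Y" and C: "compactin Y C" and A: "compactin Y A"
    and U: "openin (subtopology Y C) U" "A \<subseteq> U"
  obtains V B where "openin (subtopology Y C) V" "compactin Y B" "A \<subseteq> V" "V \<subseteq> B" "B \<subseteq> U"
proof -
  have comp: "compact_space (subtopology Y C)" and H: "Hausdorff_space (subtopology Y C)"
    using C Y by (simp_all add: compact_space_subtopology Hausdorff_space_subtopology)
  then have N: "normal_space (subtopology Y C)"
    by (simp add: compact_Hausdorff_or_regular_imp_normal_space)
  have "closedin (subtopology Y C) A"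
    using A U openin_subset[OF U(1)] by (intro compactin_imp_closedin[OF H]) (auto simp: compactin_subtopology)
  with U have "closedin (subtopology Y C) A \<and> openin (subtopology Y C) U \<and> A \<subseteq> U" by simp
  from N[unfolded normal_space_alt, rule_format, OF this] obtain V where V: "openin (subtopology Y C) V" "A \<subseteq> V" "(subtopology Y C) closure_of V \<subseteq> U"
    by (elim exE conjE)
  show ?thesis
  proof (rule that[OF V(1) _ V(2) _ V(3)])
    show "compactin Y ((subtopology Y C) closure_of V)"
      using closedin_compact_space[OF comp closedin_closure_of] by (simp add: compactin_subtopology)
    show "V \<subseteq> (subtopology Y C) closure_of V"
      by (rule closure_of_subset[OF openin_subset[OF V(1)]])
  qed
qed

text \<open>A rectangle around a point of \<open>R\<close> is grown inside \<open>R\<close> along the exhaustion: the compact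
  rectangle reached in \<open>C n\<close> has, by Wallace's theorem, a compact neighbourhood in \<open>C (Suc n)\<close>
  that is again a rectangle inside \<open>R\<close>.\<close>

lemma openin_prod_weak_topology:
  assumes Y: "Hausdorff_space Y" and C: "\<And>n. compactin Y (C n)" "\<And>n. C n \<subseteq> C (Suc n)"
    "topspace Y \<subseteq> (\<Union>n. C n)"
    and R: "R \<subseteq> topspace Y \<times> topspace Y"
    "\<And>n. openin (subtopology (prod_topology Y Y) (C n \<times> C n)) (R \<inter> C n \<times> C n)"
  shows "openin (prod_topology (weak_topology Y C) (weak_topology Y C)) R"
  unfolding openin_prod_topology_alt
proof (intro allI impI)
  have mono: "C m \<subseteq> C n" if "m \<le> n" for m n
    using that C(2) by (rule lift_Suc_mono_le[rotated])
  fix a b assume ab: "(a, b) \<in> R"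
  then have "a \<in> topspace Y" "b \<in> topspace Y" using R(1) by auto
  then obtain k l where "a \<in> C k" "b \<in> C l" using C(3) by (meson UN_E subsetD)
  then obtain N where N: "a \<in> C N" "b \<in> C N" using mono[of k "max k l"] mono[of l "max k l"] by auto
  define D where "D n = C (N + n)" for n
  define P where "P n = (\<lambda>(A, B). compactin Y A \<and> compactin Y B \<and> A \<subseteq> D n \<and> B \<subseteq> D n \<and> A \<times> B \<subseteq> R \<and> a \<in> A \<and> b \<in> B)"
    for n
  \<comment> \<open>Between consecutive compact rectangles lie relatively open ones; the unions of
    their sides will be open in the weak topology.\<close>
  define Q where "Q n = (\<lambda>(A, B) (A', B'). \<exists>U V. openin (subtopology Y (D (Suc n))) U \<and>
      openin (subtopology Y (D (Suc n))) V \<and> A \<subseteq> U \<and> U \<subseteq> A' \<and> B \<subseteq> V \<and> V \<subseteq> B')" for n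
  have "\<exists>f. \<forall>n. P n (f n) \<and> Q n (f n) (f (Suc n))"
  proof (rule dependent_nat_choice)
    show "\<exists>x. P 0 x"
      using ab N R(1) by (intro exI[of _ "({a}, {b})"]) (auto simp: P_def D_def)
    fix x n assume "P n x"
    then obtain A B where x: "x = (A, B)" and A: "compactin Y A" "A \<subseteq> D n" "a \<in> A"
      and B: "compactin Y B" "B \<subseteq> D n" "b \<in> B" and AB: "A \<times> B \<subseteq> R"
      by (cases x) (auto simp: P_def)
    let ?S = "subtopology Y (D (Suc n))"
    have D: "D n \<subseteq> D (Suc n)" "compactin Y (D (Suc n))" using C by (simp_all add: D_def)
    have "openin (prod_topology ?S ?S) (R \<inter> D (Suc n) \<times> D (Suc n))"
      using R(2)[of "N + Suc n"] by (simp add: D_def subtopology_Times)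
    moreover have "compactin ?S A" "compactin ?S B"
      using A B D by (auto simp: compactin_subtopology)
    moreover have "A \<times> B \<subseteq> R \<inter> D (Suc n) \<times> D (Suc n)" using AB A B D by blast
    ultimately obtain U V where UV: "openin ?S U" "openin ?S V" "A \<subseteq> U" "B \<subseteq> V"
        "U \<times> V \<subseteq> R \<inter> D (Suc n) \<times> D (Suc n)"
      by (metis Wallace_theorem_prod_topology)
    obtain U' A' where U': "openin ?S U'" "compactin Y A'" "A \<subseteq> U'" "U' \<subseteq> A'" "A' \<subseteq> U"
      using compact_Hausdorff_neighbourhood[OF Y D(2) A(1) UV(1,3)] .
    obtain V' B' where V': "openin ?S V'" "compactin Y B'" "B \<subseteq> V'" "V' \<subseteq> B'" "B' \<subseteq> V"
      using compact_Hausdorff_neighbourhood[OF Y D(2) B(1) UV(2,4)] .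
    have "U \<subseteq> D (Suc n)" "V \<subseteq> D (Suc n)"
      using openin_subset[OF UV(1)] openin_subset[OF UV(2)] by auto
    moreover have "A' \<times> B' \<subseteq> R" using UV(5) U'(5) V'(5) by blast
    ultimately have "P (Suc n) (A', B')" using U' V' A B by (auto simp: P_def)
    moreover have "Q n x (A', B')" using U' V' by (auto simp: Q_def x)
    ultimately show "\<exists>y. P (Suc n) y \<and> Q n x y" by blast
  qed
  then obtain f where f: "\<And>n. P n (f n)" "\<And>n. Q n (f n) (f (Suc n))" by blast
  define A where "A n = fst (f n)" for n
  define B where "B n = snd (f n)" for n
  have AB: "A n \<subseteq> D n" "B n \<subseteq> D n" "A n \<times> B n \<subseteq> R" "a \<in> A n" "b \<in> B n" for n
    using f(1)[of n] by (auto simp: P_def A_def B_def case_prod_unfold)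
  have "\<forall>n. \<exists>U V. openin (subtopology Y (D (Suc n))) U \<and> openin (subtopology Y (D (Suc n))) V \<and>
           A n \<subseteq> U \<and> U \<subseteq> A (Suc n) \<and> B n \<subseteq> V \<and> V \<subseteq> B (Suc n)"
    using f(2) by (simp add: Q_def A_def B_def case_prod_unfold)
  then obtain U V where U: "\<And>n. openin (subtopology Y (D (Suc n))) (U n)" "\<And>n. A n \<subseteq> U n" "\<And>n. U n \<subseteq> A (Suc n)"
    and V: "\<And>n. openin (subtopology Y (D (Suc n))) (V n)" "\<And>n. B n \<subseteq> V n" "\<And>n. V n \<subseteq> B (Suc n)"
    by metis
  have weak: "openin (weak_topology Y C) (\<Union>n. W n)"
    if W: "\<And>n. openin (subtopology Y (D (Suc n))) (W n)" "\<And>n. W n \<subseteq> W (Suc n)" for W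
    unfolding openin_weak_topology
  proof (intro conjI allI)
    show "(\<Union>n. W n) \<subseteq> topspace Y" using openin_subset[OF W(1)] by auto
    fix m
    have Wm: "W n \<subseteq> W (max m n)" for n
      using lift_Suc_mono_le[of W n "max m n"] W(2) by simp
    \<comment> \<open>Each term is moved to an index at least \<open>m\<close>, where the stage
      contains \<open>C m\<close>; by monotonicity the union does not change.\<close>
    have "(\<Union>n. W n) \<inter> C m = (\<Union>n. W (max m n) \<inter> C m)" using Wm by auto
    moreover have "openin (subtopology Y (C m)) (W (max m n) \<inter> C m)" for n
    proof -
      obtain G where "openin Y G" "W (max m n) = G \<inter> D (Suc (max m n))"
        using W(1)[of "max m n"] by (auto simp: openin_subtopology)
      moreover have "C m \<subseteq> D (Suc (max m n))" unfolding D_def by (rule mono) simp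
      ultimately show ?thesis by (auto simp: openin_subtopology)
    qed
    ultimately show "openin (subtopology Y (C m)) ((\<Union>n. W n) \<inter> C m)"
      by (simp only:) (intro openin_Union, blast)
  qed
  have incr: "U n \<subseteq> U (Suc n)" "V n \<subseteq> V (Suc n)" "A n \<subseteq> A (Suc n)" "B n \<subseteq> B (Suc n)" for n
    using U(2,3)[of n] U(2)[of "Suc n"] V(2,3)[of n] V(2)[of "Suc n"] by auto
  have "U n \<times> V m \<subseteq> R" for n m
  proof -
    have "A (Suc n) \<subseteq> A (Suc (max n m))" "B (Suc m) \<subseteq> B (Suc (max n m))"
      by (rule lift_Suc_mono_le[of A, OF incr(3)] lift_Suc_mono_le[of B, OF incr(4)], simp)+
    then show ?thesis using U(3)[of n] V(3)[of m] AB(3)[of "Suc (max n m)"] by blast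
  qed
  then have "(\<Union>n. U n) \<times> (\<Union>n. V n) \<subseteq> R" by blast
  moreover have "a \<in> (\<Union>n. U n)" "b \<in> (\<Union>n. V n)" using AB(4,5)[of 0] U(2)[of 0] V(2)[of 0] by auto
  ultimately show "\<exists>U V. openin (weak_topology Y C) U \<and> openin (weak_topology Y C) V \<and> a \<in> U \<and> b \<in> V \<and> U \<times> V \<subseteq> R"
    using weak[OF U(1) incr(1)] weak[OF V(1) incr(2)] by blast
qed

text \<open>For \<open>v\<close> and \<open>w\<close> in a small neighbourhood \<open>V\<close> of
  the identity, \<open>v^-1 w a\<close> avoids the closed set \<open>C\<close>. The translates
  \<open>V a\<close> and \<open>V c\<close> are then disjoint for \<open>c\<close> in
  \<open>C\<close>, since a common point would write \<open>c\<close> as such a product.\<close>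

lemma regular_space_topological_group:
  assumes "topological_group G T"
  shows "regular_space T"
  unfolding regular_space_def
proof (intro allI impI)
  have G: "group G" and T: "topspace T = carrier G"
    and m: "continuous_map (prod_topology T T) T (\<lambda>(x, y). x \<otimes>\<^bsub>G\<^esub> y)"
    and i: "continuous_map T T (\<lambda>x. inv\<^bsub>G\<^esub> x)"
    using assms by (auto simp: topological_group_def)
  interpret group G by (rule G)
  have mult: "continuous_map Y T (\<lambda>y. f y \<otimes>\<^bsub>G\<^esub> g y)"
    if "continuous_map Y T f" "continuous_map Y T g" for f g and Y :: "'c topology"
    using continuous_map_compose[OF continuous_map_pairedI[OF that] m] by (simp add: o_def)
  fix C a assume *: "closedin T C \<and> a \<in> topspace T - C"
  then have C: "closedin T C" and a: "a \<in> carrier G" "a \<notin> C" by (auto simp: T)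
  have CG: "C \<subseteq> carrier G" using closedin_subset[OF C] by (simp add: T)
  define \<phi> where "\<phi> z = inv\<^bsub>G\<^esub> (fst z) \<otimes>\<^bsub>G\<^esub> snd z \<otimes>\<^bsub>G\<^esub> a" for z
  have "continuous_map (prod_topology T T) T \<phi>"
    unfolding \<phi>_def using a
    by (intro mult continuous_map_compose[OF continuous_map_fst i, unfolded o_def] continuous_map_snd)
       (simp add: T)
  then have P: "openin (prod_topology T T) {z \<in> topspace (prod_topology T T). \<phi> z \<in> topspace T - C}"
    by (rule openin_continuous_map_preimage) (use C in \<open>simp add: openin_diff\<close>)
  have "(\<one>\<^bsub>G\<^esub>, \<one>\<^bsub>G\<^esub>) \<in> {z \<in> topspace (prod_topology T T). \<phi> z \<in> topspace T - C}"
    using a by (simp add: \<phi>_def T)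
  from P[unfolded openin_prod_topology_alt, rule_format, OF this]
  obtain V' V'' where V': "openin T V'" "openin T V''" "\<one>\<^bsub>G\<^esub> \<in> V'" "\<one>\<^bsub>G\<^esub> \<in> V''"
      "V' \<times> V'' \<subseteq> {z \<in> topspace (prod_topology T T). \<phi> z \<in> topspace T - C}"
    by (elim exE conjE)
  define V where "V = V' \<inter> V''"
  have V: "openin T V" "\<one>\<^bsub>G\<^esub> \<in> V" using V' by (simp_all add: V_def openin_Int)
  have V\<phi>: "\<phi> (v, w) \<notin> C" if "v \<in> V" "w \<in> V" for v w
    using subsetD[OF V'(5), of "(v, w)"] that by (simp add: V_def)
  have shift: "openin T {x \<in> topspace T. x \<otimes>\<^bsub>G\<^esub> inv\<^bsub>G\<^esub> c \<in> V}" if "c \<in> carrier G" for c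
    by (rule openin_continuous_map_preimage[OF mult V(1)]) (use that in \<open>simp_all add: T\<close>)
  show "\<exists>U W. openin T U \<and> openin T W \<and> a \<in> U \<and> C \<subseteq> W \<and> disjnt U W"
  proof (intro exI conjI)
    show "openin T {x \<in> topspace T. x \<otimes>\<^bsub>G\<^esub> inv\<^bsub>G\<^esub> a \<in> V}" by (rule shift[OF a(1)])
    show "openin T (\<Union>c\<in>C. {x \<in> topspace T. x \<otimes>\<^bsub>G\<^esub> inv\<^bsub>G\<^esub> c \<in> V})"
      using shift CG by (intro openin_Union) auto
    show "a \<in> {x \<in> topspace T. x \<otimes>\<^bsub>G\<^esub> inv\<^bsub>G\<^esub> a \<in> V}" using a V by (simp add: T)
    show "C \<subseteq> (\<Union>c\<in>C. {x \<in> topspace T. x \<otimes>\<^bsub>G\<^esub> inv\<^bsub>G\<^esub> c \<in> V})"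
    proof
      fix c assume "c \<in> C"
      then have "c \<in> {x \<in> topspace T. x \<otimes>\<^bsub>G\<^esub> inv\<^bsub>G\<^esub> c \<in> V}" using CG V by (auto simp: T)
      with \<open>c \<in> C\<close> show "c \<in> (\<Union>c\<in>C. {x \<in> topspace T. x \<otimes>\<^bsub>G\<^esub> inv\<^bsub>G\<^esub> c \<in> V})" by blast
    qed
    show "disjnt {x \<in> topspace T. x \<otimes>\<^bsub>G\<^esub> inv\<^bsub>G\<^esub> a \<in> V} (\<Union>c\<in>C. {x \<in> topspace T. x \<otimes>\<^bsub>G\<^esub> inv\<^bsub>G\<^esub> c \<in> V})"
    proof -
      have False if x: "x \<in> carrier G" "x \<otimes>\<^bsub>G\<^esub> inv\<^bsub>G\<^esub> a \<in> V" "c \<in> C" "x \<otimes>\<^bsub>G\<^esub> inv\<^bsub>G\<^esub> c \<in> V" for x c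
      proof -
        have c: "c \<in> carrier G" using x CG by blast
        have "inv\<^bsub>G\<^esub> (x \<otimes>\<^bsub>G\<^esub> inv\<^bsub>G\<^esub> c) \<otimes>\<^bsub>G\<^esub> (x \<otimes>\<^bsub>G\<^esub> inv\<^bsub>G\<^esub> a) \<otimes>\<^bsub>G\<^esub> a
            = c \<otimes>\<^bsub>G\<^esub> (inv\<^bsub>G\<^esub> x \<otimes>\<^bsub>G\<^esub> (x \<otimes>\<^bsub>G\<^esub> (inv\<^bsub>G\<^esub> a \<otimes>\<^bsub>G\<^esub> a)))"
          using a c x(1) by (simp add: inv_mult_group m_assoc del: l_inv)
        also have "\<dots> = c" using a c x(1) by simp
        finally show False using V\<phi>[OF x(4,2)] x(3) by (simp add: \<phi>_def)
      qed
      then show ?thesis unfolding disjnt_def T by blast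
    qed
  qed
qed

text \<open>There are countably many closed balls with rational radius and centre in a countable
  dense set; finite unions of the compact ones form the exhaustion. Inside a compact neighbourhood
  of a point lies such a ball with the point in its open part, so a stage contains a neighbourhood
  and not just the point.\<close>

lemma (in Metric_space) compact_exhaustion:
  assumes "locally_compact_space mtopology" "separable_space mtopology"
  obtains K :: "nat \<Rightarrow> 'a set" where "\<And>n. compactin mtopology (K n)" "\<And>n. K n \<subseteq> K (Suc n)"
    "\<And>x. x \<in> M \<Longrightarrow> \<exists>n U. openin mtopology U \<and> x \<in> U \<and> U \<subseteq> K n"
proof -
  obtain S where S: "countable S" "S \<subseteq> M" "mtopology closure_of S = M"
    using assms(2) unfolding separable_space_def by auto
  \<comment> \<open>The empty set keeps the family nonempty, as its enumeration requires.\<close>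
  define \<B> where "\<B> = insert {} ((\<lambda>(c, q). mcball c q) ` {(c, q) \<in> S \<times> \<rat>. compactin mtopology (mcball c q)})"
  have "countable {(c, q) \<in> S \<times> \<rat>. compactin mtopology (mcball c q)}"
    by (rule countable_subset[of _ "S \<times> \<rat>"]) (auto simp: S(1) countable_rat)
  then have "countable \<B>" unfolding \<B>_def by (intro countable_insert countable_image)
  define B where "B = from_nat_into \<B>"
  have B: "range B = \<B>"
    unfolding B_def by (rule range_from_nat_into[OF _ \<open>countable \<B>\<close>]) (simp add: \<B>_def)
  have comp: "compactin mtopology (B n)" for n
  proof -
    have "B n \<in> \<B>" using B by blast
    then show ?thesis by (auto simp: \<B>_def)
  qed
  show ?thesis
  proof (rule that[of "\<lambda>n. \<Union>i\<le>n. B i"])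
    show "compactin mtopology (\<Union>i\<le>n. B i)" for n
      by (rule compactin_Union) (auto simp: comp)
    show "(\<Union>i\<le>n. B i) \<subseteq> (\<Union>i\<le>Suc n. B i)" for n by (intro UN_mono) auto
    fix x assume x: "x \<in> M"
    then obtain U L where UL: "openin mtopology U" "compactin mtopology L" "x \<in> U" "U \<subseteq> L"
      using assms(1) unfolding locally_compact_space_def by auto
    then obtain r where r: "r > 0" "mball x r \<subseteq> U" unfolding openin_mtopology by blast
    obtain q where q: "q \<in> \<rat>" "0 < q" "q < r / 2" using Rats_dense_in_real[of 0 "r / 2"] r by auto
    have "x \<in> mtopology closure_of S" using S x by simp
    then obtain c where c: "c \<in> S" "c \<in> mball x q" using q(2) unfolding metric_closure_of by blast
    have sub: "mcball c q \<subseteq> L"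
    proof
      fix y assume y: "y \<in> mcball c q"
      then have "d x y \<le> d x c + d c y" using triangle[of x c y] x c by auto
      then have "y \<in> mball x r" using y c q x by auto
      then show "y \<in> L" using r UL by blast
    qed
    have "compactin mtopology (mcball c q)"
      by (rule closed_compactin[OF UL(2) sub]) simp
    then have "mcball c q \<in> \<B>" using c q by (auto simp: \<B>_def)
    then obtain n where n: "B n = mcball c q" using B by (metis rangeE)
    show "\<exists>n U. openin mtopology U \<and> x \<in> U \<and> U \<subseteq> (\<Union>i\<le>n. B i)"
    proof (intro exI conjI)
      show "openin mtopology (mball c q)" by simp
      show "x \<in> mball c q" using c by (simp add: commute)
      show "mball c q \<subseteq> (\<Union>i\<le>n. B i)" using n mball_subset_mcball[of c q] by blast
    qed
  qed
qed

section \<open>Free topological groups over spaces with a compact exhaustion\<close>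

definition bounded_words :: "'a set \<Rightarrow> nat \<Rightarrow> 'a word set" where
  "bounded_words K m = {w. reduced_word w \<and> set w \<subseteq> UNIV \<times> K \<and> length w \<le> m}"

lemma bounded_words_0: "bounded_words K 0 = {[]}"
  by (auto simp: bounded_words_def)

text \<open>Prepares the compactness induction: each stage is the image of a product of compact sets
  under the continuous multiplication. The empty word in the first factor accounts for
  \<open>[]\<close> itself.\<close>

lemma bounded_words_Suc:
  "bounded_words K (Suc m) =
     (\<lambda>(u, v). foldr push u v) ` (insert [] (\<Union>b. (\<lambda>x. [(b, x)]) ` K) \<times> bounded_words K m)" (is "?L = ?R")
proof
  show "?L \<subseteq> ?R"
  proof
    fix w assume w: "w \<in> ?L"
    show "w \<in> ?R"
    proof (cases w)
      case Nil
      then show ?thesis by (intro image_eqI[of _ _ "([], [])"]) (auto simp: bounded_words_def)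
    next
      case (Cons a v)
      with w show ?thesis
        by (intro image_eqI[of _ _ "([a], v)"])
           (auto simp: bounded_words_def push_reduced dest: reduced_ConsD)
    qed
  qed
  show "?R \<subseteq> ?L"
  proof
    fix w assume "w \<in> ?R"
    then obtain u v where w: "w = foldr push u v" and u: "u \<in> insert [] (\<Union>b. (\<lambda>x. [(b, x)]) ` K)"
      and v: "v \<in> bounded_words K m" by auto
    have "length u \<le> 1" "set u \<subseteq> UNIV \<times> K" using u by auto
    then show "w \<in> ?L"
      using v set_foldr_push[of u v] length_foldr_push[of u v]
      by (auto simp: w bounded_words_def reduced_foldr_push)
  qed
qed

lemma compactin_bounded_words:
  assumes K: "compactin X K"
  shows "compactin (free_topology X) (bounded_words K m)"
proof (induction m)
  case 0
  then show ?case
    by (simp add: bounded_words_0 topspace_free_topology carrier_free_group)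
next
  case (Suc m)
  have "continuous_map X (free_topology X) (\<lambda>x. [(b, x)])" for b
    using continuous_map_push[OF continuous_map_Nil continuous_map_id, of X b] by simp
  then have "compactin (free_topology X) ((\<lambda>x. [(b, x)]) ` K)" for b
    by (rule image_compactin[OF K])
  then have "compactin (free_topology X) (\<Union>b. (\<lambda>x. [(b, x)]) ` K)"
    by (intro compactin_Union) auto
  moreover have "compactin (free_topology X) {[]}"
    by (simp add: topspace_free_topology carrier_free_group)
  ultimately have "compactin (free_topology X) (insert [] (\<Union>b. (\<lambda>x. [(b, x)]) ` K))"
    using compactin_Un[of "free_topology X" "{[]}"] by simp
  with Suc have "compactin (prod_topology (free_topology X) (free_topology X))
      (insert [] (\<Union>b. (\<lambda>x. [(b, x)]) ` K) \<times> bounded_words K m)"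
    unfolding compactin_Times by (intro disjI2 conjI)
  then show ?case
    unfolding bounded_words_Suc by (rule image_compactin[OF _ continuous_map_foldr_push])
qed

section \<open>Coherence of the free topology with compact sets of words\<close>

context
  fixes X :: "'a topology" and K :: "nat \<Rightarrow> 'a set" and C :: "nat \<Rightarrow> 'a word set"
  assumes F: "Hausdorff_space (free_topology X)"
    and K: "\<And>n. compactin X (K n)" "\<And>n. K n \<subseteq> K (Suc n)"
      "\<And>x. x \<in> topspace X \<Longrightarrow> \<exists>n U. openin X U \<and> x \<in> U \<and> U \<subseteq> K n"
  defines "C \<equiv> \<lambda>n. bounded_words (K n) n"
begin

lemma exhaustion_mono: "m \<le> n \<Longrightarrow> K m \<subseteq> K n"
  by (rule lift_Suc_mono_le[of K, OF K(2)])

lemma word_exhaustion_compact: "compactin (free_topology X) (C n)"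
  unfolding C_def by (rule compactin_bounded_words[OF K(1)])

lemma word_exhaustion_Suc: "C n \<subseteq> C (Suc n)"
  using K(2)[of n] by (auto simp: C_def bounded_words_def)

lemma word_exhaustion_covers: "topspace (free_topology X) \<subseteq> (\<Union>n. C n)"
proof
  fix w assume "w \<in> topspace (free_topology X)"
  then have w: "reduced_word w" "set w \<subseteq> UNIV \<times> topspace X"
    by (auto simp: topspace_free_topology carrier_free_group)
  have "\<forall>x\<in>topspace X. \<exists>n. x \<in> K n" using K(3) by blast
  then obtain f where f: "\<And>x. x \<in> topspace X \<Longrightarrow> x \<in> K (f x)" by metis
  \<comment> \<open>The sum dominates both the length of the word and the stage of each of its
    letters.\<close>
  define n where "n = length w + sum f (snd ` set w)"
  have "x \<in> K n" if "(b, x) \<in> set w" for b x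
  proof -
    have "x \<in> snd ` set w" using that by force
    then have "f x \<le> sum f (snd ` set w)" by (intro member_le_sum) auto
    then have "f x \<le> n" by (simp add: n_def)
    moreover have "x \<in> K (f x)" using f w(2) that by blast
    ultimately show ?thesis using exhaustion_mono by blast
  qed
  then have "w \<in> C n" using w by (auto simp: C_def bounded_words_def n_def)
  then show "w \<in> (\<Union>n. C n)" by blast
qed

text \<open>Multiplication maps \<open>C n \<times> C n\<close> into \<open>C (n + n)\<close> and
  inversion preserves \<open>C n\<close>, so both are continuous stage by stage. For inversion this
  suffices at once; for multiplication it suffices because openness in the product of the weak
  topologies can be tested on the squares \<open>C n \<times> C n\<close>.\<close>

lemma topological_group_weak_topology:
  "topological_group (free_group (topspace X)) (weak_topology (free_topology X) C)"
proof -
  let ?F = "free_topology X" and ?G = "free_group (topspace X)"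
  let ?T = "weak_topology ?F C"
  interpret group ?G by (rule group_free_group)
  note m = continuous_map_foldr_push[of X]
  have i: "continuous_map ?F ?F (\<lambda>x. inv\<^bsub>?G\<^esub> x)"
    using topological_group_free_topology[of X] by (simp add: topological_group_def)
  have inv: "inv\<^bsub>?G\<^esub> w = rev (map inv_letter w)" if "w \<in> carrier ?G" for w
    using that foldr_push_inverse[of w] by (intro inv_equality)
      (simp_all add: mult_free_group one_free_group inverse_in_free_group)
  have "openin (prod_topology ?T ?T) {z \<in> topspace (prod_topology ?T ?T). (case z of (u, v) \<Rightarrow> foldr push u v) \<in> U}"
    (is "openin _ ?R") if U: "openin ?T U" for U
  proof (rule openin_prod_weak_topology[OF F word_exhaustion_compact word_exhaustion_Suc word_exhaustion_covers])
    show "?R \<subseteq> topspace ?F \<times> topspace ?F" by auto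
    fix n
    have img: "foldr push u v \<in> C (n + n)" if "u \<in> C n" "v \<in> C n" for u v
      using that set_foldr_push[of u v] length_foldr_push[of u v] exhaustion_mono[of n "n + n"]
      unfolding C_def bounded_words_def by (simp add: reduced_foldr_push) blast
    have "continuous_map (subtopology (prod_topology ?F ?F) (C n \<times> C n)) (subtopology ?F (C (n + n)))
        (\<lambda>(u, v). foldr push u v)"
      using img by (auto intro!: continuous_map_into_subtopology continuous_map_from_subtopology[OF m])
    moreover have "openin (subtopology ?F (C (n + n))) (U \<inter> C (n + n))"
      using U by (simp add: openin_weak_topology)
    ultimately have "openin (subtopology (prod_topology ?F ?F) (C n \<times> C n))
       {z \<in> topspace (subtopology (prod_topology ?F ?F) (C n \<times> C n)).
         (case z of (u, v) \<Rightarrow> foldr push u v) \<in> U \<inter> C (n + n)}"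
      by (rule openin_continuous_map_preimage)
    moreover have "{z \<in> topspace (subtopology (prod_topology ?F ?F) (C n \<times> C n)).
         (case z of (u, v) \<Rightarrow> foldr push u v) \<in> U \<inter> C (n + n)} = ?R \<inter> C n \<times> C n"
      using img by auto
    ultimately show "openin (subtopology (prod_topology ?F ?F) (C n \<times> C n)) (?R \<inter> C n \<times> C n)"
      by simp
  qed
  moreover have "(\<lambda>(u, v). foldr push u v) \<in> topspace (prod_topology ?T ?T) \<rightarrow> topspace ?T"
    using m by (simp add: continuous_map_def)
  ultimately have mult: "continuous_map (prod_topology ?T ?T) ?T (\<lambda>(u, v). foldr push u v)"
    unfolding continuous_map_def by blast
  have "openin ?T {w \<in> topspace ?T. inv\<^bsub>?G\<^esub> w \<in> U}" if U: "openin ?T U" for U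
    unfolding openin_weak_topology
  proof (intro conjI allI)
    fix n
    have Cn: "C n \<subseteq> topspace ?F" by (rule compactin_subset_topspace[OF word_exhaustion_compact])
    have img: "inv\<^bsub>?G\<^esub> w \<in> C n" if "w \<in> C n" for w
    proof -
      have "inv\<^bsub>?G\<^esub> w = rev (map inv_letter w)" using that Cn inv by (auto simp: topspace_free_topology)
      then show ?thesis
        using that by (auto simp: C_def bounded_words_def reduced_inverse inv_letter_def)
    qed
    have "continuous_map (subtopology ?F (C n)) (subtopology ?F (C n)) (\<lambda>w. inv\<^bsub>?G\<^esub> w)"
      using img by (auto intro!: continuous_map_into_subtopology continuous_map_from_subtopology[OF i])
    moreover have "openin (subtopology ?F (C n)) (U \<inter> C n)"
      using U by (simp add: openin_weak_topology)
    ultimately have "openin (subtopology ?F (C n))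
        {w \<in> topspace (subtopology ?F (C n)). inv\<^bsub>?G\<^esub> w \<in> U \<inter> C n}"
      by (rule openin_continuous_map_preimage)
    moreover have "{w \<in> topspace (subtopology ?F (C n)). inv\<^bsub>?G\<^esub> w \<in> U \<inter> C n} =
        {w \<in> topspace ?T. inv\<^bsub>?G\<^esub> w \<in> U} \<inter> C n"
      using img by auto
    ultimately show "openin (subtopology ?F (C n)) ({w \<in> topspace ?T. inv\<^bsub>?G\<^esub> w \<in> U} \<inter> C n)"
      by simp
  qed auto
  moreover have "(\<lambda>w. inv\<^bsub>?G\<^esub> w) \<in> topspace ?T \<rightarrow> topspace ?T"
    using i by (simp add: continuous_map_def)
  ultimately have "continuous_map ?T ?T (\<lambda>w. inv\<^bsub>?G\<^esub> w)"
    unfolding continuous_map_def by blast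
  with mult show ?thesis
    by (simp add: topological_group_def group_free_group mult_free_group topspace_free_topology)
qed

text \<open>Each point has a neighbourhood inside some \<open>K n\<close>, on which the generators
  stay in a single stage; there the weak and the free topology agree.\<close>

lemma continuous_map_generator_weak_topology:
  "continuous_map X (weak_topology (free_topology X) C) generator"
  unfolding continuous_map_def
proof (intro conjI allI impI)
  let ?F = "free_topology X"
  show "generator \<in> topspace X \<rightarrow> topspace (weak_topology ?F C)"
    by (auto simp: topspace_free_topology generator_in_free_group)
  fix U assume U: "openin (weak_topology ?F C) U"
  show "openin X {x \<in> topspace X. generator x \<in> U}" (is "openin X ?P")
  proof (subst openin_subopen, intro ballI)
    fix x assume x: "x \<in> ?P"
    then obtain n G where G: "openin X G" "x \<in> G" "G \<subseteq> K n" using K(3) by blast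
    \<comment> \<open>The successor leaves room for words of length 1 even when
      \<open>n = 0\<close>.\<close>
    have img: "generator y \<in> C (Suc n)" if "y \<in> G" for y
      using that G K(2)[of n] by (auto simp: C_def bounded_words_def generator_def)
    have "continuous_map (subtopology X G) (subtopology ?F (C (Suc n))) generator"
      using img by (auto intro!: continuous_map_into_subtopology
          continuous_map_from_subtopology[OF continuous_map_generator])
    moreover have "openin (subtopology ?F (C (Suc n))) (U \<inter> C (Suc n))"
      using U by (simp add: openin_weak_topology)
    ultimately have "openin (subtopology X G)
        {y \<in> topspace (subtopology X G). generator y \<in> U \<inter> C (Suc n)}"
      by (rule openin_continuous_map_preimage)
    then have "openin X {y \<in> topspace (subtopology X G). generator y \<in> U \<inter> C (Suc n)}"
      using G(1) by (simp add: openin_open_subtopology)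
    moreover have "x \<in> {y \<in> topspace (subtopology X G). generator y \<in> U \<inter> C (Suc n)}"
      using x G img by auto
    ultimately show "\<exists>T. openin X T \<and> x \<in> T \<and> T \<subseteq> ?P" by (intro exI conjI; assumption?) auto
  qed
qed

text \<open>The free topology contains every group topology that makes the generators continuous, in
  particular the weak one.\<close>

lemma openin_free_topology_exhaustion:
  assumes "U \<subseteq> topspace (free_topology X)" "\<And>n. openin (subtopology (free_topology X) (C n)) (U \<inter> C n)"
  shows "openin (free_topology X) U"
  by (rule openin_free_topology[OF topological_group_weak_topology continuous_map_generator_weak_topology])
     (simp add: openin_weak_topology assms)

lemma k_space_free_topology_exhaustion: "k_space (free_topology X)"
  unfolding k_space_open
proof (intro allI impI)
  fix S assume S: "S \<subseteq> topspace (free_topology X) \<and>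
      (\<forall>L. compactin (free_topology X) L \<longrightarrow> openin (subtopology (free_topology X) L) (L \<inter> S))"
  show "openin (free_topology X) S"
  proof (rule openin_free_topology_exhaustion)
    show "openin (subtopology (free_topology X) (C n)) (S \<inter> C n)" for n
      using S word_exhaustion_compact[of n] by (subst Int_commute) blast
  qed (use S in blast)
qed

text \<open>Within \<open>C n\<close> the words in question form a compact, hence closed, set.
  Closedness is what passes the k-space property on to the words of bounded length.\<close>

lemma closedin_free_topology_le_exhaustion:
  "closedin (free_topology X) {w \<in> carrier (free_group (topspace X)). length w \<le> m}"
  unfolding closedin_def
proof (intro conjI openin_free_topology_exhaustion)
  let ?F = "free_topology X" and ?L = "{w \<in> carrier (free_group (topspace X)). length w \<le> m}"
  fix n
  have CF: "C n \<subseteq> topspace ?F" by (rule compactin_subset_topspace[OF word_exhaustion_compact])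
  have eq: "(topspace ?F - ?L) \<inter> C n = C n - bounded_words (K n) (min m n)"
    using CF by (auto simp: topspace_free_topology C_def bounded_words_def)
  have "closedin ?F (bounded_words (K n) (min m n))"
    by (rule compactin_imp_closedin[OF F compactin_bounded_words[OF K(1)]])
  then have "openin ?F (topspace ?F - bounded_words (K n) (min m n))" by blast
  moreover have "C n - bounded_words (K n) (min m n) = (topspace ?F - bounded_words (K n) (min m n)) \<inter> C n"
    using CF by blast
  ultimately show "openin (subtopology ?F (C n)) ((topspace ?F - ?L) \<inter> C n)"
    unfolding eq openin_subtopology by blast
qed (auto simp: topspace_free_topology)

text \<open>The compact stages make the space Lindelof; a regular Lindelof space is normal, and a
  regular normal space is completely regular.\<close>

lemma completely_regular_free_topology_exhaustion: "completely_regular_space (free_topology X)"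
proof -
  let ?F = "free_topology X"
  have "Lindelof_space (subtopology ?F (\<Union> (range C)))"
    using word_exhaustion_compact
    by (intro Lindelof_space_Union) (auto intro: compact_imp_Lindelof_space compact_space_subtopology)
  moreover have "subtopology ?F (\<Union> (range C)) = ?F"
    using word_exhaustion_covers by (intro subtopology_superset) simp
  ultimately have "Lindelof_space ?F" by simp
  moreover have "regular_space ?F"
    by (rule regular_space_topological_group[OF topological_group_free_topology])
  ultimately show ?thesis
    by (intro normal_imp_completely_regular_space regular_Lindelof_imp_normal_space) auto
qed

end

section \<open>The discrete case and the equivalence\<close>

text \<open>The discrete topology is itself a group topology with continuous generators, so the free
  topology contains it.\<close>

lemma free_topology_discrete:
  "free_topology (discrete_topology A) = discrete_topology (carrier (free_group A))"
proof -
  interpret group "free_group A" by (rule group_free_group)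
  have "topological_group (free_group A) (discrete_topology (carrier (free_group A)))"
    by (auto simp: topological_group_def group_free_group continuous_map_def simp flip: prod_topology_discrete_topology)
  moreover have "continuous_map (discrete_topology A) (discrete_topology (carrier (free_group A))) generator"
    by (auto simp: generator_in_free_group)
  ultimately have "openin (free_topology (discrete_topology A)) {w}" if "w \<in> carrier (free_group A)" for w
    using openin_free_topology[of "discrete_topology A" _ "{w}"] that by simp
  then show ?thesis
    by (subst eq_commute, subst discrete_topology_unique) (simp add: topspace_free_topology)
qed

lemma free_topology_k_space_tychonoff:
  assumes X: "metrizable_space X"
    and "(locally_compact_space X \<and> separable_space X) \<or> X = discrete_topology (topspace X)"
  shows "k_space (free_topology X)" "k_space (free_topology_le n X)" "tychonoff_space (free_topology_le n X)"
proof -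
  have "k_space (free_topology X) \<and> k_space (free_topology_le n X) \<and> tychonoff_space (free_topology_le n X)"
  \<comment> \<open>The discrete case is separate because an uncountable discrete space has no
    countable exhaustion by compact sets.\<close>
  proof (cases "X = discrete_topology (topspace X)")
    case True
    let ?G = "carrier (free_group (topspace X))"
    have "free_topology X = discrete_topology ?G"
      using free_topology_discrete[of "topspace X"] True by simp
    moreover from this have "free_topology_le n X = discrete_topology (?G \<inter> {w \<in> ?G. length w \<le> n})"
      by (simp add: free_topology_le_def subtopology_discrete_topology)
    ultimately show ?thesis
      by (simp add: k_space_discrete_topology tychonoff_space_def completely_regular_space_discrete_topology
          Hausdorff_space_discrete_topology)
  next
    case False
    then have X': "locally_compact_space X" "separable_space X" using assms(2) by auto
    have F: "Hausdorff_space (free_topology X)"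
      using X by (intro Hausdorff_space_free_topology metrizable_imp_normal_space metrizable_imp_Hausdorff_space)
    obtain M d where "Metric_space M d" and XM: "X = Metric_space.mtopology M d"
      using X unfolding metrizable_space_def by blast
    interpret Metric_space M d by fact
    obtain K where K: "\<And>n. compactin X (K n)" "\<And>n. K n \<subseteq> K (Suc n)"
        "\<And>x. x \<in> topspace X \<Longrightarrow> \<exists>n U. openin X U \<and> x \<in> U \<and> U \<subseteq> K n"
      using compact_exhaustion X' by (auto simp: XM)
    note cl = closedin_free_topology_le_exhaustion[OF F K, of n]
    show ?thesis
      using k_space_free_topology_exhaustion[OF F K] k_space_closed_subtopology[OF _ cl]
        completely_regular_free_topology_exhaustion[OF F K] F
      by (simp add: free_topology_le_def tychonoff_space_def completely_regular_space_subtopology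
          Hausdorff_space_subtopology)
  qed
  then show "k_space (free_topology X)" "k_space (free_topology_le n X)" "tychonoff_space (free_topology_le n X)"
    by blast+
qed

theorem theorem3p6:
  fixes X :: "'a topology"
  assumes "metrizable_space X" and "topspace X \<noteq> {}"
  shows "(k_space (free_topology X) \<longleftrightarrow> k_space (free_topology_le 8 X)) \<and>
         (k_space (free_topology_le 8 X) \<longleftrightarrow> kR_space (free_topology_le 8 X)) \<and>
         (kR_space (free_topology_le 8 X) \<longleftrightarrow>
            (locally_compact_space X \<and> separable_space X) \<or> X = discrete_topology (topspace X))"
proof -
  let ?P = "(locally_compact_space X \<and> separable_space X) \<or> X = discrete_topology (topspace X)"
  let ?L = "{w \<in> carrier (free_group (topspace X)). length w \<le> 8}"
  have whole: "subtopology (free_topology X) (carrier (free_group (topspace X))) = free_topology X"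
    by (intro subtopology_superset) (simp add: topspace_free_topology)
  have 1: "?P" if "k_space (free_topology X)"
    by (rule compactly_continuous_imp_locally_compact_separable_or_discrete
          [OF assms(1), of "carrier (free_group (topspace X))"])
       (use that in \<open>simp_all only: whole continuous_map_from_k_space\<close>)
  have 2: "?P" if "k_space (free_topology_le 8 X)"
    by (rule compactly_continuous_imp_locally_compact_separable_or_discrete[OF assms(1), of ?L])
       (use that[unfolded free_topology_le_def] in \<open>simp_all add: continuous_map_from_k_space\<close>)
  have 3: "?P" if "kR_space (free_topology_le 8 X)"
    by (rule compactly_continuous_imp_locally_compact_separable_or_discrete[OF assms(1), of ?L])
       (use that[unfolded free_topology_le_def kR_space_def] in simp_all)
  have 4: "kR_space (free_topology_le 8 X)" if ?P
    using free_topology_k_space_tychonoff[OF assms(1) that] continuous_map_from_k_space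
    unfolding kR_space_def by blast
  show ?thesis
    using 1 2 3 4 free_topology_k_space_tychonoff[OF assms(1)] by blast
qed

end
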